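(* Consider the collinear relative equilibria of the four-vortex problem with $\Gamma_1=\Gamma_2=1$, $\Gamma_3=\Gamma_4=m$, counted up to equivalence. For $m\in(0,1]$ there are exactly 12 collinear solutions, one for each possible ordering of the vortices along the line (orderings being identified with their reversals). If $m=1$, all solutions are symmetric and geometrically equivalent to the same configuration; otherwise (i.e. for $m\in(0,1)$) there are 4 symmetric solutions and 8 asymmetric solutions. For $m\in(-1/2,0)$ there are a total of 6 solutions, 2 symmetric and 4 asymmetric, while for $m\in(-1,-1/2]$ there are only 2 symmetric solutions and no asymmetric solutions.
   Context: Four point vortices have distinct positions $x_i$ and strengths $\Gamma_i\in\mathbb{R}\setminus\{0\}$; here the positions are collinear. Taking the line to be $\mathbb{R}$, the configuration is a relative equilibrium (central configuration) if there are $\lambda\in\mathbb{R}\setminus\{0\}$ and $c\in\mathbb{R}$ with $-\lambda(x_i-c)=\sum_{j\neq i}\frac{\Gamma_j}{x_j-x_i}$ for $i=1,\dots,4$. Vortices are labelled; two solutions are equivalent if one is obtained from the other by translation, scaling by a positive factor, and rotation in the plane (so a collinear configuration is identified with its image under a $180^\circ$ rotation). A collinear configuration is symmetric if the set of the four positions is invariant under reflection through some point of the line, and asymmetric otherwise. Geometrically equivalent means equal up to scaling, translation, rotation and relabelling of the vortices. *)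

theory Defs
  imports "HOL-Analysis.Analysis"
begin

text \<open>
  Four labelled point vortices on the line are given by a vector of positions and a vector of
  strengths, both in \<^typ>\<open>real ^ 4\<close>.  The labels are the elements \<open>1, 2, 3, 4\<close>
  of the index type \<^typ>\<open>4\<close> (where \<open>4 = 0\<close>).
\<close>

definition collinear_rel_equilibrium :: "real ^ 4 \<Rightarrow> real ^ 4 \<Rightarrow> bool" where
  "collinear_rel_equilibrium \<Gamma> x \<longleftrightarrow>
     inj (\<lambda>i. x $ i) \<and>
     (\<exists>l c :: real. l \<noteq> 0 \<and>
        (\<forall>i. - l * (x $ i - c) = (\<Sum>j\<in>UNIV - {i}. \<Gamma> $ j / (x $ j - x $ i))))"

text \<open>
  Equivalence of labelled configurations, with the line embedded as the real axis of the plane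
  \<^typ>\<open>complex\<close>: a scaling by \<open>s > 0\<close>, a rotation by \<open>t\<close> and a translation by \<open>b\<close>.
  Reflections of the plane are not allowed.
\<close>

definition config_equiv :: "real ^ 4 \<Rightarrow> real ^ 4 \<Rightarrow> bool" where
  "config_equiv x y \<longleftrightarrow>
     (\<exists>(s :: real) (t :: real) (b :: complex). s > 0 \<and>
        (\<forall>i. complex_of_real (y $ i) = complex_of_real s * cis t * complex_of_real (x $ i) + b))"

definition config_rel :: "(real ^ 4) rel" where
  "config_rel = {(x, y). config_equiv x y}"

definition geometrically_equivalent :: "real ^ 4 \<Rightarrow> real ^ 4 \<Rightarrow> bool" where
  "geometrically_equivalent x y \<longleftrightarrow>
     (\<exists>p :: 4 \<Rightarrow> 4. bij p \<and> config_equiv x (\<chi> i. y $ p i))"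

text \<open>Only the set of positions has to be invariant, regardless of the labels and strengths.\<close>

definition symmetric_config :: "real ^ 4 \<Rightarrow> bool" where
  "symmetric_config x \<longleftrightarrow>
     (\<exists>p :: real. (\<lambda>y. 2 * p - y) ` range (\<lambda>i. x $ i) = range (\<lambda>i. x $ i))"

text \<open>The labels listed from left to right along the line.\<close>

definition vortex_order :: "real ^ 4 \<Rightarrow> 4 list" where
  "vortex_order x = sort_key (\<lambda>i. x $ i) [1, 2, 3, 4]"

text \<open>The possible orderings, each identified with its reversal.\<close>

definition orderings_up_to_reversal :: "4 list set set" where
  "orderings_up_to_reversal = {{os, rev os} | os. distinct os \<and> set os = UNIV}"

definition two_pairs :: "real \<Rightarrow> real ^ 4" where
  "two_pairs m = (\<chi> i. if i = 1 \<or> i = 2 then 1 else m)"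

text \<open>
  A solution is an equivalence class of relative equilibria.  Equivalence preserves being a
  relative equilibrium and being symmetric, so the symmetric and the asymmetric solutions are
  the classes of the symmetric and of the asymmetric relative equilibria.
\<close>

definition solutions :: "real \<Rightarrow> (real ^ 4) set set" where
  "solutions m = {x. collinear_rel_equilibrium (two_pairs m) x} // config_rel"

definition symmetric_solutions :: "real \<Rightarrow> (real ^ 4) set set" where
  "symmetric_solutions m =
     {x. collinear_rel_equilibrium (two_pairs m) x \<and> symmetric_config x} // config_rel"

definition asymmetric_solutions :: "real \<Rightarrow> (real ^ 4) set set" where
  "asymmetric_solutions m =
     {x. collinear_rel_equilibrium (two_pairs m) x \<and> \<not> symmetric_config x} // config_rel"

end

theory Submission
  imports Defs "HOL-Combinatorics.Multiset_Permutations"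
begin

text \<open>
  An affine map of the line brings the first pair of vortices to \<open>-1\<close> and \<open>1\<close>, so a solution up to
  equivalence is a pair \<open>(q, r)\<close>, where the second pair is at \<open>q - r\<close> and \<open>q + r\<close>
  (\<open>bij_betw_normal_config_classes\<close>).  Taking suitable differences of the four equations eliminates the
  constant \<open>c\<close> and leaves three equations for the multiplier, one of which is void for \<open>q = 0\<close>
  (\<open>rel_equilibrium_normal_config_iff\<close>).

  For \<open>q = 0\<close> they reduce to \<open>r\<^sup>4 - 5 * (1 + m) * r\<^sup>2 + m = 0\<close>.  The quadratic in \<open>r\<^sup>2\<close> has two positive
  roots for \<open>m > 0\<close> and one for \<open>-1 < m < 0\<close>, hence there are 4 or 2 solutions.  For \<open>q \<noteq> 0\<close>, with \<open>Q = q\<^sup>2\<close>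
  and \<open>R = r\<^sup>2\<close>, eliminating the multiplier leads to

  \<open>(Q - 1 - R)\<^sup>2 = 4 * (1 + 2 * m) * (Q - 1)\<close> and \<open>m * (Q - 1 - R)\<^sup>2 = 4 * (2 + m) * R * (Q - R)\<close>.

  For \<open>m > -1/2\<close> the solutions with \<open>R > 0\<close> correspond to certain roots of a quadratic polynomial in
  \<open>s = R - Q\<close> (\<open>off_centre_eqs_iff\<close>): two admissible roots for \<open>m > 0\<close>, one for \<open>m < 0\<close>, and each of them gives four
  choices of signs for \<open>(q, r)\<close>.  For \<open>-1 < m \<le> -1/2\<close> the inequality of arithmetic and geometric means shows that
  no solution exists (\<open>no_off_centre_solution\<close>).  The solutions with \<open>q = 0\<close> are symmetric, and a solution
  with \<open>q \<noteq> 0\<close> is symmetric only if \<open>r\<^sup>2 = 1\<close>, which happens exactly for \<open>m = 1\<close>.  This gives all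
  the numbers in the theorem.

  The bijection with the orderings is obtained by counting.  For positive strengths the equilibria
  with given ordering are critical points of a strictly convex function, so there is at most one class
  per ordering (\<open>positive_rel_equilibrium_unique\<close>), and there are 12 classes and 12 orderings.  The same
  uniqueness, applied after a relabelling, shows that for \<open>m = 1\<close> all solutions are geometrically
  equivalent.
\<close>

section \<open>Equivalence classes and their normal forms\<close>

text \<open>
  A rotation that maps two points of the real axis to real points is a rotation by a multiple of
  \<open>\<pi>\<close>, so on the line only \<open>y = a x + b\<close> with \<open>a\<close> of either sign remains.  A configuration whose
  points all coincide can be rotated arbitrarily, but then a translation gives the same image.
\<close>

lemma config_equiv_iff_affine:
  "config_equiv x y \<longleftrightarrow> (\<exists>a b. a \<noteq> 0 \<and> (\<forall>i. y $ i = a * x $ i + b))"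
proof
  assume "config_equiv x y"
  then obtain s t b where s: "s > 0" and
    e: "\<And>i. complex_of_real (y $ i) = complex_of_real s * cis t * complex_of_real (x $ i) + b"
    unfolding config_equiv_def by blast
  have re: "y $ i = s * cos t * x $ i + Re b" and im: "0 = s * sin t * x $ i + Im b" for i
    using arg_cong[OF e[of i], of Re] arg_cong[OF e[of i], of Im] by simp_all
  show "\<exists>a b. a \<noteq> 0 \<and> (\<forall>i. y $ i = a * x $ i + b)"
  proof (cases "sin t = 0")
    case True
    then have "cos t \<noteq> 0"
      using sin_cos_squared_add[of t] by auto
    with s re show ?thesis
      by (intro exI[of _ "s * cos t"] exI[of _ "Re b"]) auto
  next
    case False
    then have x: "x $ i = - Im b / (s * sin t)" for i
      using im[of i] s by (simp add: field_simps)
    have "y $ i = 1 * x $ i + (y $ 1 - x $ 1)" for i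
      using re[of i] re[of 1] x[of i] x[of 1] by simp
    then show ?thesis
      using zero_neq_one by metis
  qed
next
  assume "\<exists>a b. a \<noteq> 0 \<and> (\<forall>i. y $ i = a * x $ i + b)"
  then obtain a b where "a \<noteq> 0" and e: "\<And>i. y $ i = a * x $ i + b" by blast
  then consider "a > 0" | "a < 0" by linarith
  then show "config_equiv x y"
  proof cases
    case 1
    then show ?thesis
      unfolding config_equiv_def using e
      by (intro exI[of _ a] exI[of _ 0] exI[of _ "complex_of_real b"]) auto
  next
    case 2
    then show ?thesis
      unfolding config_equiv_def using e
      by (intro exI[of _ "- a"] exI[of _ pi] exI[of _ "complex_of_real b"]) auto
  qed
qed

lemma config_relI:
  assumes "a \<noteq> 0" "\<And>i. y $ i = a * x $ i + b"
  shows "(x, y) \<in> config_rel"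
  unfolding config_rel_def config_equiv_iff_affine using assms by blast

lemma config_relE:
  assumes "(x, y) \<in> config_rel"
  obtains a b where "a \<noteq> 0" "\<And>i. y $ i = a * x $ i + b"
  using assms unfolding config_rel_def config_equiv_iff_affine by blast

lemma equiv_config_rel: "equiv UNIV config_rel"
proof (rule equivI)
  show "refl config_rel"
  proof (rule refl_onI)
    show "(x, x) \<in> config_rel" for x
      by (rule config_relI[of 1 _ _ 0]) simp_all
  qed
  show "sym config_rel"
  proof (rule symI)
    fix x y assume "(x, y) \<in> config_rel"
    then obtain a b where "a \<noteq> 0" "\<And>i. y $ i = a * x $ i + b"
      by (metis config_relE)
    then show "(y, x) \<in> config_rel"
      by (intro config_relI[of "1 / a" _ _ "- b / a"]) (simp_all add: field_simps)
  qed
  show "trans config_rel"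
  proof (rule transI)
    fix x y z assume "(x, y) \<in> config_rel" "(y, z) \<in> config_rel"
    then obtain a b a' b' where "a \<noteq> 0" "\<And>i. y $ i = a * x $ i + b"
      "a' \<noteq> 0" "\<And>i. z $ i = a' * y $ i + b'"
      by (metis config_relE)
    then show "(x, z) \<in> config_rel"
      by (intro config_relI[of "a' * a" _ _ "a' * b + b'"]) (simp_all add: algebra_simps)
  qed
qed simp

lemma collinear_rel_equilibrium_imp_inj:
  "collinear_rel_equilibrium \<Gamma> x \<Longrightarrow> inj (\<lambda>i. x $ i)"
  by (simp add: collinear_rel_equilibrium_def)

lemma collinear_rel_equilibrium_affine:
  assumes "collinear_rel_equilibrium \<Gamma> x" "a \<noteq> 0"
  shows "collinear_rel_equilibrium \<Gamma> (\<chi> i. a * x $ i + b)"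
proof -
  obtain l c where l: "l \<noteq> 0" and inj: "inj (\<lambda>i. x $ i)" and
    e: "\<And>i. - l * (x $ i - c) = (\<Sum>j\<in>UNIV - {i}. \<Gamma> $ j / (x $ j - x $ i))"
    using assms(1) unfolding collinear_rel_equilibrium_def by blast
  have "- (l / a\<^sup>2) * (a * x $ i + b - (a * c + b)) =
      (\<Sum>j\<in>UNIV - {i}. \<Gamma> $ j / (a * x $ j + b - (a * x $ i + b)))" for i
  proof -
    have "- (l / a\<^sup>2) * (a * x $ i + b - (a * c + b)) = (- l * (x $ i - c)) / a"
      using assms(2) by (simp add: field_simps power2_eq_square)
    also have "\<dots> = (\<Sum>j\<in>UNIV - {i}. \<Gamma> $ j / (x $ j - x $ i) / a)"
      by (simp only: e sum_divide_distrib)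
    also have "\<dots> = (\<Sum>j\<in>UNIV - {i}. \<Gamma> $ j / (a * x $ j + b - (a * x $ i + b)))"
      by (intro sum.cong refl) (simp add: algebra_simps)
    finally show ?thesis .
  qed
  moreover have "inj (\<lambda>i. (\<chi> i. a * x $ i + b) $ i)"
    using inj assms(2) by (auto simp: inj_def)
  moreover have "l / a\<^sup>2 \<noteq> 0"
    using l assms(2) by simp
  ultimately show ?thesis
    unfolding collinear_rel_equilibrium_def vec_lambda_beta by blast
qed

lemma symmetric_config_affine:
  assumes "symmetric_config x"
  shows "symmetric_config (\<chi> i. a * x $ i + b)"
proof -
  obtain p where p: "(\<lambda>y. 2 * p - y) ` range (\<lambda>i. x $ i) = range (\<lambda>i. x $ i)"
    using assms unfolding symmetric_config_def by blast
  define f where "f = (\<lambda>y. a * y + b)"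
  have r: "range (\<lambda>i. (\<chi> i. a * x $ i + b) $ i) = f ` range (\<lambda>i. x $ i)"
    by (auto simp: f_def)
  have "(\<lambda>y. 2 * (a * p + b) - y) ` f ` range (\<lambda>i. x $ i) = f ` (\<lambda>y. 2 * p - y) ` range (\<lambda>i. x $ i)"
    unfolding image_image f_def by (simp add: algebra_simps)
  then show ?thesis
    unfolding symmetric_config_def r p by metis
qed

lemma symmetric_config_affine_iff:
  assumes "a \<noteq> 0"
  shows "symmetric_config (\<chi> i. a * x $ i + b) \<longleftrightarrow> symmetric_config x"
proof
  assume "symmetric_config (\<chi> i. a * x $ i + b)"
  from symmetric_config_affine[OF this, of "1 / a" "- b / a"]
  show "symmetric_config x"
    using assms by (simp add: field_simps)
qed (rule symmetric_config_affine)

text \<open>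
  An affine map of the line takes the two vortices of the first pair to \<open>-1\<close> and \<open>1\<close>.  The
  coordinates that remain are the centre \<open>q\<close> of the second pair and its signed half-width \<open>r\<close>.  With
  this choice, whether a configuration is an equilibrium depends only on \<open>q\<^sup>2\<close> and \<open>r\<^sup>2\<close>.
\<close>

definition normal_config :: "real \<Rightarrow> real \<Rightarrow> real ^ 4" where
  "normal_config q r = (\<chi> i. if i = 1 then -1 else if i = 2 then 1 else if i = 3 then q - r else q + r)"

lemma normal_config_nth [simp]:
  "normal_config q r $ 1 = -1" "normal_config q r $ 2 = 1"
  "normal_config q r $ 3 = q - r" "normal_config q r $ 4 = q + r"
  by (simp_all add: normal_config_def)

lemma affine_image_normal_config:
  assumes "inj (\<lambda>i. x $ i)"
  obtains a b q r where "a \<noteq> 0" "(\<chi> i. a * x $ i + b) = normal_config q r"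
proof -
  have ne: "x $ 2 - x $ 1 \<noteq> 0"
    using injD[OF assms, of 1 2] by auto
  define a where "a = 2 / (x $ 2 - x $ 1)"
  define b where "b = - (x $ 1 + x $ 2) / (x $ 2 - x $ 1)"
  define y where "y = (\<chi> i. a * x $ i + b)"
  have "a \<noteq> 0" using ne by (simp add: a_def)
  moreover have "y = normal_config ((y $ 3 + y $ 4) / 2) ((y $ 4 - y $ 3) / 2)"
    unfolding vec_eq_iff forall_4 using ne
    by (simp add: y_def a_def b_def add_divide_distrib [symmetric] diff_divide_distrib [symmetric])
       (simp add: field_simps)
  ultimately show ?thesis
    using that unfolding y_def by blast
qed

text \<open>
  An affine map is determined by the images of two points, so every class contains exactly one
  normal form, and counting classes is counting pairs \<open>(q, r)\<close>.
\<close>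

lemma bij_betw_normal_config_classes:
  assumes inj: "\<And>x. x \<in> A \<Longrightarrow> inj (\<lambda>i. x $ i)"
    and affine: "\<And>x a b. x \<in> A \<Longrightarrow> a \<noteq> 0 \<Longrightarrow> (\<chi> i. a * x $ i + b) \<in> A"
  shows "bij_betw (\<lambda>(q, r). config_rel `` {normal_config q r})
           {(q, r). normal_config q r \<in> A} (A // config_rel)"
  unfolding bij_betw_def
proof
  show "inj_on (\<lambda>(q, r). config_rel `` {normal_config q r}) {(q, r). normal_config q r \<in> A}"
  proof (rule inj_onI, clarify)
    fix q r q' r'
    assume "config_rel `` {normal_config q r} = config_rel `` {normal_config q' r'}"
    then have "(normal_config q r, normal_config q' r') \<in> config_rel"
      using eq_equiv_class[OF _ equiv_config_rel] by blast
    then obtain a b where e: "\<And>i. normal_config q' r' $ i = a * normal_config q r $ i + b"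
      unfolding config_rel_def config_equiv_iff_affine by blast
    from e[of 1] e[of 2] have "a = 1" "b = 0" by simp_all
    with e[of 3] e[of 4] show "q = q' \<and> r = r'" by simp
  qed
  have "config_rel `` {x} \<in> (\<lambda>(q, r). config_rel `` {normal_config q r}) ` {(q, r). normal_config q r \<in> A}"
    if x: "x \<in> A" for x
  proof -
    obtain a b q r where a: "a \<noteq> 0" and y: "(\<chi> i. a * x $ i + b) = normal_config q r"
      using affine_image_normal_config[OF inj[OF x]] by blast
    have "(x, normal_config q r) \<in> config_rel"
      unfolding y[symmetric] by (rule config_relI[OF a]) simp
    then have "config_rel `` {x} = config_rel `` {normal_config q r}"
      by (rule equiv_class_eq[OF equiv_config_rel])
    moreover have "normal_config q r \<in> A"
      using affine[OF x a, of b] by (simp add: y)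
    ultimately show ?thesis by auto
  qed
  then show "(\<lambda>(q, r). config_rel `` {normal_config q r}) ` {(q, r). normal_config q r \<in> A} = A // config_rel"
    by (auto simp: quotient_def)
qed

lemma card_affine_classes:
  assumes "\<And>x. x \<in> A \<Longrightarrow> inj (\<lambda>i. x $ i)"
    and "\<And>x a b. x \<in> A \<Longrightarrow> a \<noteq> 0 \<Longrightarrow> (\<chi> i. a * x $ i + b) \<in> A"
  shows "card (A // config_rel) = card {(q, r). normal_config q r \<in> A}"
  using bij_betw_same_card[OF bij_betw_normal_config_classes[OF assms]] by simp

text \<open>
  A symmetric quadruple is symmetric about its mean, which is \<open>q / 2\<close>; the cases \<open>r\<^sup>2 = 1\<close> are those in
  which the reflection exchanges vortices of different pairs.
\<close>

lemma symmetric_normal_config_iff: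
  assumes "inj (\<lambda>i. normal_config q r $ i)"
  shows "symmetric_config (normal_config q r) \<longleftrightarrow> q = 0 \<or> r\<^sup>2 = 1"
proof -
  have range: "range (\<lambda>i. normal_config q r $ i) = {-1, 1, q - r, q + r}"
    unfolding UNIV_4 by simp
  show ?thesis
  proof
    assume "symmetric_config (normal_config q r)"
    then obtain p where p: "(\<lambda>y. 2 * p - y) ` {-1, 1, q - r, q + r} = {-1, 1, q - r, q + r}"
      unfolding symmetric_config_def range by blast
    have "(\<Sum>i\<in>UNIV. normal_config q r $ i) = \<Sum> {-1, 1, q - r, q + r}"
      unfolding range[symmetric] using assms by (simp add: sum.reindex)
    then have s: "\<Sum> {-1, 1, q - r, q + r} = 2 * q"
      by (simp add: sum_4)
    have "card {-1, 1, q - r, q + r} = 4"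
      unfolding range[symmetric] using assms by (simp add: card_image)
    moreover have "\<Sum> {-1, 1, q - r, q + r} = (\<Sum>y\<in>{-1, 1, q - r, q + r}. 2 * p - y)"
      by (subst p[symmetric], subst sum.reindex) (auto simp: inj_on_def)
    ultimately have "2 * q = 8 * p - 2 * q"
      unfolding sum_subtractf s by simp
    then have "2 * p = q" by simp
    have "2 * p - (-1) \<in> {-1, 1, q - r, q + r}" "2 * p - 1 \<in> {-1, 1, q - r, q + r}"
      using p by blast+
    then show "q = 0 \<or> r\<^sup>2 = 1"
      unfolding \<open>2 * p = q\<close> by (auto simp: power2_eq_1_iff)
  next
    assume "q = 0 \<or> r\<^sup>2 = 1"
    then have "(\<lambda>y. 2 * (q / 2) - y) ` {-1, 1, q - r, q + r} = {-1, 1, q - r, q + r}"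
      by (auto simp: power2_eq_1_iff)
    then show "symmetric_config (normal_config q r)"
      unfolding symmetric_config_def range by blast
  qed
qed

section \<open>Positive strengths: uniqueness for each ordering\<close>

text \<open>
  Weighted by the strengths, the interactions of the vortices form an antisymmetric kernel; summing against \<open>f\<close> then sees only
  differences of \<open>f\<close>.  Both the sign of the multiplier and the uniqueness below come from this.
\<close>

lemma sum_antisymmetric_kernel:
  fixes f :: "'n::finite \<Rightarrow> real"
  assumes "\<And>i j. k i j = - k j i"
  shows "2 * (\<Sum>i\<in>UNIV. f i * (\<Sum>j\<in>UNIV. k i j)) = (\<Sum>i\<in>UNIV. \<Sum>j\<in>UNIV. (f i - f j) * k i j)"
proof -
  have "(\<Sum>i\<in>UNIV. \<Sum>j\<in>UNIV. (f i - f j) * k i j)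
      = (\<Sum>i\<in>UNIV. \<Sum>j\<in>UNIV. f i * k i j) + (\<Sum>i\<in>UNIV. \<Sum>j\<in>UNIV. f j * k j i)"
    unfolding sum.distrib[symmetric]
  proof (intro sum.cong refl)
    fix i j show "(f i - f j) * k i j = f i * k i j + f j * k j i"
      using assms[of i j] by (simp add: algebra_simps)
  qed
  also have "(\<Sum>i\<in>UNIV. \<Sum>j\<in>UNIV. f j * k j i) = (\<Sum>i\<in>UNIV. \<Sum>j\<in>UNIV. f i * k i j)"
    by (rule sum.swap)
  finally show ?thesis
    by (simp add: sum_distrib_left)
qed

lemma sum_weighted_squares_nonpos:
  fixes f :: "'n::finite \<Rightarrow> real"
  assumes "\<And>i. g i > 0" "(\<Sum>i\<in>UNIV. g i * (f i)\<^sup>2) \<le> 0"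
  shows "f i = 0"
proof -
  have nn: "\<And>i. g i * (f i)\<^sup>2 \<ge> 0"
    using assms(1) by (simp add: less_imp_le)
  have "(\<Sum>i\<in>UNIV. g i * (f i)\<^sup>2) = 0"
    using assms(2) sum_nonneg[of UNIV "\<lambda>i. g i * (f i)\<^sup>2"] nn by force
  then have "g i * (f i)\<^sup>2 = 0"
    using sum_nonneg_eq_0_iff[of UNIV "\<lambda>i. g i * (f i)\<^sup>2"] nn by simp
  then show ?thesis
    using assms(1)[of i] by simp
qed

lemma sum_delete_conv_UNIV:
  fixes f :: "'n::finite \<Rightarrow> real"
  assumes "f i = 0"
  shows "sum f (UNIV - {i}) = sum f UNIV"
  using assms by (simp add: sum_diff1)

text \<open>
  Multiplying the equations by \<open>g i * (x i - c)\<close> and summing relates \<open>l\<close> times the moment of inertia to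
  the sum of the products \<open>g i * g j\<close> over the pairs of vortices.  In the sums over all of
  \<open>UNIV\<close> here and below, the term \<open>j = i\<close> is a division by zero and contributes \<open>0\<close>.
\<close>

lemma positive_strengths_multiplier_pos:
  fixes x :: "'n::finite \<Rightarrow> real"
  assumes pos: "\<And>i. g i > 0" and "x i \<noteq> x j" and "l \<noteq> 0"
    and eq: "\<And>i. - l * (x i - c) = (\<Sum>j\<in>UNIV. g j / (x j - x i))"
  shows "l > 0"
proof -
  define k where "k = (\<lambda>i j. g i * g j / (x j - x i))"
  define I where "I = (\<Sum>i\<in>UNIV. g i * (x i - c)\<^sup>2)"
  have k: "k i j = - k j i" for i j
    unfolding k_def by (subst minus_diff_eq[symmetric], subst divide_minus_right) (simp add: mult.commute)
  have "(x i - c) * (\<Sum>j\<in>UNIV. k i j) = - l * (g i * (x i - c)\<^sup>2)" for i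
  proof -
    have "(\<Sum>j\<in>UNIV. k i j) = g i * (- l * (x i - c))"
      unfolding eq k_def sum_distrib_left by simp
    then show ?thesis by (simp only:) (simp add: power2_eq_square)
  qed
  then have "2 * (- l * I) = (\<Sum>i\<in>UNIV. \<Sum>j\<in>UNIV. ((x i - c) - (x j - c)) * k i j)"
    unfolding I_def sum_distrib_left[of "- l"] sum_antisymmetric_kernel[OF k, symmetric] by simp
  also have "\<dots> \<le> 0"
  proof (intro sum_nonpos)
    fix i j
    show "((x i - c) - (x j - c)) * k i j \<le> 0"
    proof (cases "x i = x j")
      case False
      then have "((x i - c) - (x j - c)) * k i j = - (g i * g j)"
        by (simp add: k_def divide_simps) (simp add: algebra_simps)
      then show ?thesis using pos[of i] pos[of j] by simp
    qed simp
  qed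
  finally have "l * I \<ge> 0" by linarith
  moreover have "I > 0"
  proof (rule ccontr)
    assume "\<not> I > 0"
    then have "x i - c = 0" for i
      unfolding I_def by (intro sum_weighted_squares_nonpos[of g "\<lambda>i. x i - c"] pos) simp_all
    then have "x i = x j" by (metis eq_iff_diff_eq_0)
    with assms(2) show False by simp
  qed
  ultimately show ?thesis
    using \<open>l \<noteq> 0\<close> by (simp add: zero_le_mult_iff)
qed

text \<open>
  The equilibria with multiplier 1 are the critical points of
  \<open>(\<Sum>i. g i * (u i)\<^sup>2) / 2 - (\<Sum>i<j. g i * g j * ln \<bar>u i - u j\<bar>)\<close>, which is strictly convex on the cone
  of configurations in a given order.  The proof is the corresponding monotonicity of the gradient: paired
  with the difference \<open>v - u\<close>, the logarithmic terms contribute with one sign and the quadratic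
  terms with the opposite one.
\<close>

lemma ordered_equilibria_unique:
  fixes u v :: "'n::finite \<Rightarrow> real"
  assumes pos: "\<And>i. g i > 0"
    and u: "inj u" "\<And>i. - u i = (\<Sum>j\<in>UNIV. g j / (u j - u i))"
    and v: "inj v" "\<And>i. - v i = (\<Sum>j\<in>UNIV. g j / (v j - v i))"
    and ord: "\<And>i j. u i < u j \<longleftrightarrow> v i < v j"
  shows "u = v"
proof -
  define k where "k = (\<lambda>i j. g i * g j * (1 / (v j - v i) - 1 / (u j - u i)))"
  define f where "f = (\<lambda>i. v i - u i)"
  have k: "k i j = - k j i" for i j
  proof -
    have "1 / (w i - w j) = - (1 / (w j - w i))" for w :: "'n \<Rightarrow> real"
      by (subst minus_diff_eq[symmetric], subst divide_minus_right) simp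
    from this[of u] this[of v] show ?thesis
      unfolding k_def by (simp add: algebra_simps)
  qed
  have "f i * (\<Sum>j\<in>UNIV. k i j) = - (g i * (f i)\<^sup>2)" for i
  proof -
    have "(\<Sum>j\<in>UNIV. k i j) = g i * (- v i - - u i)"
      unfolding u(2) v(2) k_def sum_subtractf[symmetric] sum_distrib_left
      by (simp add: algebra_simps)
    then show ?thesis by (simp only: f_def) (simp add: power2_eq_square algebra_simps)
  qed
  then have "- 2 * (\<Sum>i\<in>UNIV. g i * (f i)\<^sup>2) = (\<Sum>i\<in>UNIV. \<Sum>j\<in>UNIV. (f i - f j) * k i j)"
    unfolding sum_antisymmetric_kernel[OF k, symmetric] by (simp add: sum_negf)
  also have "\<dots> \<ge> 0"
  proof (intro sum_nonneg)
    fix i j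
    show "(f i - f j) * k i j \<ge> 0"
    proof (cases "i = j")
      case False
      define a where "a = u j - u i"
      define b where "b = v j - v i"
      have "a \<noteq> 0" "b \<noteq> 0"
        using False u(1) v(1) by (auto simp: a_def b_def inj_eq)
      moreover have "a > 0 \<longleftrightarrow> b > 0"
        using ord[of i j] by (simp add: a_def b_def)
      ultimately have ab: "a * b > 0"
        by (auto simp: zero_less_mult_iff)
      have "(f i - f j) * k i j = g i * g j * ((a - b) * (1 / b - 1 / a))"
        by (simp add: f_def k_def a_def b_def)
      also have "(a - b) * (1 / b - 1 / a) = (a - b)\<^sup>2 / (a * b)"
        using \<open>a \<noteq> 0\<close> \<open>b \<noteq> 0\<close> by (simp add: field_simps power2_eq_square)
      finally show ?thesis
        using ab pos[of i] pos[of j] by simp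
    qed simp
  qed
  finally have "(\<Sum>i\<in>UNIV. g i * (f i)\<^sup>2) \<le> 0" by simp
  then have "f i = 0" for i
    by (rule sum_weighted_squares_nonpos[OF pos])
  then show ?thesis
    unfolding f_def fun_eq_iff by simp
qed

text \<open>
  Moving \<open>c\<close> to the origin and scaling by the square root of the multiplier, which is positive, makes the
  multiplier equal to 1.
\<close>

lemma positive_rel_equilibrium_normalised:
  assumes pos: "\<And>i. \<Gamma> $ i > 0" and "collinear_rel_equilibrium \<Gamma> x"
  obtains s c where "s > 0"
    "\<And>i. - (s * (x $ i - c)) = (\<Sum>j\<in>UNIV. \<Gamma> $ j / (s * (x $ j - c) - s * (x $ i - c)))"
proof -
  obtain l c where "l \<noteq> 0" and inj: "inj (\<lambda>i. x $ i)" and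
    e: "\<And>i. - l * (x $ i - c) = (\<Sum>j\<in>UNIV - {i}. \<Gamma> $ j / (x $ j - x $ i))"
    using assms(2) unfolding collinear_rel_equilibrium_def by blast
  have e': "- l * (x $ i - c) = (\<Sum>j\<in>UNIV. \<Gamma> $ j / (x $ j - x $ i))" for i
    unfolding e by (rule sum_delete_conv_UNIV) simp
  have "x $ 1 \<noteq> x $ 2"
    using injD[OF inj, of 1 2] by auto
  then have "l > 0"
    by (rule positive_strengths_multiplier_pos[OF pos _ \<open>l \<noteq> 0\<close> e'])
  define s where "s = sqrt l"
  have s: "s > 0" "l = s\<^sup>2"
    using \<open>l > 0\<close> by (simp_all add: s_def)
  have "- (s * (x $ i - c)) = (\<Sum>j\<in>UNIV. \<Gamma> $ j / (s * (x $ j - c) - s * (x $ i - c)))" for i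
  proof -
    have "- (s * (x $ i - c)) = (- l * (x $ i - c)) / s"
      using s by (simp add: power2_eq_square)
    also have "\<dots> = (\<Sum>j\<in>UNIV. \<Gamma> $ j / (x $ j - x $ i) / s)"
      unfolding e' sum_divide_distrib ..
    also have "\<dots> = (\<Sum>j\<in>UNIV. \<Gamma> $ j / (s * (x $ j - c) - s * (x $ i - c)))"
      by (intro sum.cong refl) (simp add: algebra_simps)
    finally show ?thesis .
  qed
  with s(1) show ?thesis using that by blast
qed

lemma positive_rel_equilibrium_unique:
  assumes pos: "\<And>i. \<Gamma> $ i > 0"
    and "collinear_rel_equilibrium \<Gamma> x" "collinear_rel_equilibrium \<Gamma> y"
    and ord: "\<And>i j. x $ i < x $ j \<longleftrightarrow> y $ i < y $ j"
  shows "config_equiv x y"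
proof -
  obtain s c where s: "s > 0"
    "\<And>i. - (s * (x $ i - c)) = (\<Sum>j\<in>UNIV. \<Gamma> $ j / (s * (x $ j - c) - s * (x $ i - c)))"
    using positive_rel_equilibrium_normalised[OF pos assms(2)] by blast
  obtain t d where t: "t > 0"
    "\<And>i. - (t * (y $ i - d)) = (\<Sum>j\<in>UNIV. \<Gamma> $ j / (t * (y $ j - d) - t * (y $ i - d)))"
    using positive_rel_equilibrium_normalised[OF pos assms(3)] by blast
  have inj: "inj (\<lambda>i. x $ i)" "inj (\<lambda>i. y $ i)"
    using assms(2,3) by (simp_all add: collinear_rel_equilibrium_def)
  have "(\<lambda>i. s * (x $ i - c)) = (\<lambda>i. t * (y $ i - d))"
    using s t inj ord by (intro ordered_equilibria_unique[of "\<lambda>i. \<Gamma> $ i"] pos) (auto simp: inj_def)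
  then have "s * (x $ i - c) = t * (y $ i - d)" for i
    by (simp add: fun_eq_iff)
  then have "y $ i = (s / t) * x $ i + (d - s / t * c)" for i
    using t(1) by (simp add: field_simps)
  moreover have "s / t \<noteq> 0" using s(1) t(1) by simp
  ultimately show ?thesis
    unfolding config_equiv_iff_affine by blast
qed

section \<open>Orderings of the vortices\<close>

lemma vortex_order_permutation: "distinct (vortex_order x)" "set (vortex_order x) = UNIV"
proof -
  show "distinct (vortex_order x)"
    by (simp add: vortex_order_def)
  show "set (vortex_order x) = UNIV"
    unfolding vortex_order_def set_sort by (simp only: UNIV_4 list.set)
qed

lemma vortex_order_sorted: "sorted (map (\<lambda>i. x $ i) (vortex_order x))"
  unfolding vortex_order_def by simp

lemma vortex_order_eqI:
  assumes "inj (\<lambda>i. x $ i)" "distinct os" "set os = UNIV" "sorted (map (\<lambda>i. x $ i) os)"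
  shows "vortex_order x = os"
proof (rule map_sorted_distinct_set_unique)
  show "inj_on (\<lambda>i. x $ i) (set (vortex_order x) \<union> set os)"
    using assms(1) by (rule inj_on_subset) simp
  show "sorted (map (\<lambda>i. x $ i) (vortex_order x))"
    unfolding vortex_order_def by simp
  show "distinct (map (\<lambda>i. x $ i) (vortex_order x))" "distinct (map (\<lambda>i. x $ i) os)"
    using assms(2) vortex_order_permutation(1)[of x] inj_on_subset[OF assms(1) subset_UNIV]
    by (simp_all add: distinct_map)
  show "set (vortex_order x) = set os"
    unfolding assms(3) by (rule vortex_order_permutation(2))
qed (rule assms(4))

lemma vortex_order_affine:
  assumes "inj (\<lambda>i. x $ i)" "a \<noteq> 0"
  shows "vortex_order (\<chi> i. a * x $ i + b) = (if a > 0 then vortex_order x else rev (vortex_order x))"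
proof (rule vortex_order_eqI)
  show "inj (\<lambda>i. (\<chi> i. a * x $ i + b) $ i)"
    using assms by (auto simp: inj_def)
  have x: "sorted_wrt (\<lambda>i j. x $ i \<le> x $ j) (vortex_order x)"
    using vortex_order_sorted[of x] by (simp add: sorted_wrt_map)
  show "sorted (map (\<lambda>i. (\<chi> i. a * x $ i + b) $ i) (if a > 0 then vortex_order x else rev (vortex_order x)))"
    unfolding sorted_wrt_map using assms(2)
    by (auto simp: sorted_wrt_rev intro!: sorted_wrt_mono_rel[OF _ x] mult_left_mono_neg)
qed (auto simp: vortex_order_permutation)

lemma vortex_order_eq_imp_less_iff:
  assumes "inj (\<lambda>i. x $ i)" "inj (\<lambda>i. y $ i)" "vortex_order x = vortex_order y"
  shows "x $ i < x $ j \<longleftrightarrow> y $ i < y $ j"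
proof -
  define os where "os = vortex_order x"
  have less: "z $ (os ! a) < z $ (os ! b) \<longleftrightarrow> a < b"
    if "inj (\<lambda>i. z $ i)" "vortex_order z = os" "a < length os" "b < length os" for z a b
  proof -
    have le: "z $ (os ! a) \<le> z $ (os ! b)" if "a \<le> b" "b < length os" for a b
      using sorted_nth_mono[OF vortex_order_sorted[of z], of a b] that \<open>vortex_order z = os\<close> by simp
    have "z $ (os ! a) = z $ (os ! b) \<longleftrightarrow> a = b"
      using that inj_eq[OF that(1)] nth_eq_iff_index_eq[of os a b] vortex_order_permutation(1)[of z] by auto
    then show ?thesis
      using le[of a b] le[of b a] that by (cases a b rule: linorder_cases) auto
  qed
  obtain a b where "i = os ! a" "j = os ! b" "a < length os" "b < length os"
    using vortex_order_permutation(2)[of x] unfolding os_def[symmetric] by (metis UNIV_I in_set_conv_nth)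
  then show ?thesis
    using less[of x a b] less[of y a b] assms by (simp add: os_def)
qed

text \<open>
  The first and the last label of a permutation differ, so it is not its own reversal, and the 24 permutations fall into pairs.
\<close>

lemma card_orderings_up_to_reversal: "card orderings_up_to_reversal = 12"
proof -
  define S where "S = {os :: 4 list. distinct os \<and> set os = UNIV}"
  have S: "S = permutations_of_set UNIV"
    by (auto simp: S_def permutations_of_set_def)
  have "card S = fact (card (UNIV :: 4 set))"
    unfolding S by (rule card_permutations_of_set) simp
  then have cS: "card S = 24"
    by (simp add: fact_numeral)
  then have fS: "finite S"
    by (intro card_ge_0_finite) simp
  have O: "orderings_up_to_reversal = (\<lambda>os. {os, rev os}) ` S"
    by (auto simp: orderings_up_to_reversal_def S_def)
  have U: "\<Union> orderings_up_to_reversal = S"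
    unfolding O by (auto simp: S_def)
  have ne: "rev os \<noteq> os" if "os \<in> S" for os
  proof -
    have "length os = 4"
      using that distinct_card[of os] by (simp add: S_def)
    then have "hd os \<noteq> last os"
      using that by (auto simp: S_def numeral_eq_Suc length_Suc_conv)
    then show ?thesis
      by (metis hd_rev)
  qed
  have "2 * card orderings_up_to_reversal = card (\<Union> orderings_up_to_reversal)"
  proof (rule card_partition)
    show "finite orderings_up_to_reversal" unfolding O using fS by simp
    show "finite (\<Union> orderings_up_to_reversal)" unfolding U by (rule fS)
    show "card C = 2" if C: "C \<in> orderings_up_to_reversal" for C
    proof -
      obtain os where "os \<in> S" "C = {os, rev os}"
        using C unfolding O by blast
      then show ?thesis using ne[of os] by simp
    qed
    show "C \<inter> C' = {}" if "C \<in> orderings_up_to_reversal" "C' \<in> orderings_up_to_reversal" "C \<noteq> C'" for C C'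
      using that unfolding O by auto
  qed
  then show ?thesis unfolding U cS by simp
qed

lemma vortex_order_class:
  assumes "inj (\<lambda>i. x $ i)"
  shows "vortex_order ` (config_rel `` {x}) = {vortex_order x, rev (vortex_order x)}"
proof -
  have "vortex_order y \<in> {vortex_order x, rev (vortex_order x)}" if y: "(x, y) \<in> config_rel" for y
  proof -
    obtain a b where "a \<noteq> 0" "y = (\<chi> i. a * x $ i + b)"
      using y by (elim config_relE) (auto simp: vec_eq_iff)
    then show ?thesis
      using vortex_order_affine[OF assms, of a b] by auto
  qed
  moreover have "vortex_order (\<chi> i. a * x $ i + 0) \<in> vortex_order ` (config_rel `` {x})" if "a \<noteq> 0" for a
  proof -
    have "(x, \<chi> i. a * x $ i + 0) \<in> config_rel"
      by (rule config_relI[OF that]) simp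
    then show ?thesis
      by (intro imageI ImageI) simp_all
  qed
  from this[of 1] this[of "-1"]
  have "{vortex_order x, rev (vortex_order x)} \<subseteq> vortex_order ` (config_rel `` {x})"
    by (simp add: vortex_order_affine[OF assms, of 1 0, simplified]
      vortex_order_affine[OF assms, of "-1" 0, simplified])
  ultimately show ?thesis by blast
qed

text \<open>
  For positive strengths uniqueness makes the map to the orderings injective.  If there are as many
  classes as orderings, surjectivity follows by counting.
\<close>

lemma bij_betw_orderings:
  assumes pos: "\<And>i. \<Gamma> $ i > 0"
    and card: "card ({x. collinear_rel_equilibrium \<Gamma> x} // config_rel) = 12"
  shows "bij_betw (\<lambda>C. vortex_order ` C) ({x. collinear_rel_equilibrium \<Gamma> x} // config_rel)
    orderings_up_to_reversal"
proof -
  let ?S = "{x. collinear_rel_equilibrium \<Gamma> x} // config_rel"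
  have inj: "inj (\<lambda>i. x $ i)" if "collinear_rel_equilibrium \<Gamma> x" for x
    using that by (simp add: collinear_rel_equilibrium_def)
  have inj_order: "inj_on (\<lambda>C. vortex_order ` C) ?S"
  proof (rule inj_onI)
    fix C D assume "C \<in> ?S" "D \<in> ?S" and eq: "vortex_order ` C = vortex_order ` D"
    then obtain x y where x: "collinear_rel_equilibrium \<Gamma> x" "C = config_rel `` {x}"
      and y: "collinear_rel_equilibrium \<Gamma> y" "D = config_rel `` {y}"
      unfolding quotient_def by auto
    have "vortex_order x \<in> vortex_order ` D"
      unfolding eq[symmetric] x(2) vortex_order_class[OF inj[OF x(1)]] by simp
    then obtain z where z: "z \<in> D" "vortex_order z = vortex_order x" by auto
    have yz: "(y, z) \<in> config_rel" using z(1) y(2) by simp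
    then obtain a b where "a \<noteq> 0" "z = (\<chi> i. a * y $ i + b)"
      unfolding config_rel_def config_equiv_iff_affine by (auto simp: vec_eq_iff)
    then have "collinear_rel_equilibrium \<Gamma> z"
      using collinear_rel_equilibrium_affine[OF y(1)] by simp
    then have "config_equiv x z"
      using z(2) by (intro positive_rel_equilibrium_unique[OF pos x(1)]
          vortex_order_eq_imp_less_iff inj x(1)) simp_all
    then have "(x, z) \<in> config_rel" by (simp add: config_rel_def)
    then have "config_rel `` {x} = config_rel `` {z}"
      by (rule equiv_class_eq[OF equiv_config_rel])
    also have "\<dots> = config_rel `` {y}"
      using equiv_class_eq[OF equiv_config_rel yz] ..
    finally show "C = D"
      unfolding x(2) y(2) .
  qed
  have sub: "(\<lambda>C. vortex_order ` C) ` ?S \<subseteq> orderings_up_to_reversal"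
  proof
    fix W assume "W \<in> (\<lambda>C. vortex_order ` C) ` ?S"
    then obtain x where "collinear_rel_equilibrium \<Gamma> x" "W = vortex_order ` (config_rel `` {x})"
      unfolding quotient_def by auto
    then have W: "W = {vortex_order x, rev (vortex_order x)}"
      using vortex_order_class inj by simp
    show "W \<in> orderings_up_to_reversal"
      unfolding orderings_up_to_reversal_def W
      by (rule CollectI, rule exI[of _ "vortex_order x"]) (simp add: vortex_order_permutation)
  qed
  have "finite orderings_up_to_reversal"
    by (rule card_ge_0_finite) (simp add: card_orderings_up_to_reversal)
  moreover have "card ((\<lambda>C. vortex_order ` C) ` ?S) = card orderings_up_to_reversal"
    using card_image[OF inj_order] card card_orderings_up_to_reversal by simp
  ultimately have "(\<lambda>C. vortex_order ` C) ` ?S = orderings_up_to_reversal"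
    using sub by (intro card_subset_eq)
  with inj_order show ?thesis
    by (rule bij_betw_imageI)
qed

text \<open>
  Relabel \<open>z\<close> so that its vortices appear in the same order as those of \<open>x\<close>.  With equal strengths
  the relabelled configuration is again a relative equilibrium, hence equivalent to \<open>x\<close>.
\<close>

lemma equal_strengths_geometrically_equivalent:
  assumes "\<And>i. \<Gamma> $ i = g" "g > 0"
    and x: "collinear_rel_equilibrium \<Gamma> x" and z: "collinear_rel_equilibrium \<Gamma> z"
  shows "geometrically_equivalent x z"
proof -
  define xs where "xs = vortex_order x"
  define zs where "zs = vortex_order z"
  have xs: "distinct xs" "set xs = UNIV" and zs: "distinct zs" "set zs = UNIV"
    by (simp_all add: xs_def zs_def vortex_order_permutation)
  have len: "length xs = length zs"
    using distinct_card[OF xs(1)] distinct_card[OF zs(1)] xs zs by simp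
  define p where "p = (\<lambda>i. the (map_of (zip xs zs) i))"
  have p: "map p xs = zs"
    using len xs(1) by (intro nth_equalityI) (simp_all add: p_def map_of_zip_nth)
  have "surj p"
    using arg_cong[OF p, of set] xs zs by simp
  then have bij: "bij p"
    by (simp add: bij_def finite_UNIV_surj_inj)
  define w where "w = (\<chi> i. z $ p i)"
  have zinj: "inj (\<lambda>i. z $ i)"
    using z by (simp add: collinear_rel_equilibrium_def)
  have winj: "inj (\<lambda>i. w $ i)"
    using zinj bij by (auto simp: w_def inj_def bij_def)
  obtain l c where l: "l \<noteq> 0" and
    e: "\<And>i. - l * (z $ i - c) = (\<Sum>j\<in>UNIV - {i}. \<Gamma> $ j / (z $ j - z $ i))"
    using z unfolding collinear_rel_equilibrium_def by blast
  have "- l * (w $ i - c) = (\<Sum>j\<in>UNIV - {i}. \<Gamma> $ j / (w $ j - w $ i))" for i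
  proof -
    have "bij_betw p (UNIV - {i}) (UNIV - {p i})"
      using bij by (auto simp: bij_betw_def inj_on_def bij_def dest: surjD)
    from sum.reindex_bij_betw[OF this, of "\<lambda>j. \<Gamma> $ j / (z $ j - z $ p i)"]
    have "(\<Sum>j\<in>UNIV - {i}. \<Gamma> $ j / (w $ j - w $ i)) = (\<Sum>j\<in>UNIV - {p i}. \<Gamma> $ j / (z $ j - z $ p i))"
      by (simp add: w_def assms(1))
    then show ?thesis using e[of "p i"] by (simp add: w_def)
  qed
  then have w: "collinear_rel_equilibrium \<Gamma> w"
    unfolding collinear_rel_equilibrium_def using winj l by blast
  have "vortex_order w = xs"
  proof (rule vortex_order_eqI[OF winj xs])
    have "map (\<lambda>i. w $ i) xs = map (\<lambda>i. z $ i) zs"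
      unfolding p[symmetric] by (simp add: w_def)
    then show "sorted (map (\<lambda>i. w $ i) xs)"
      using vortex_order_sorted[of z] by (simp add: zs_def)
  qed
  moreover have "inj (\<lambda>i. x $ i)"
    using x by (simp add: collinear_rel_equilibrium_def)
  ultimately have "config_equiv x w"
    using assms by (intro positive_rel_equilibrium_unique[OF _ x w] vortex_order_eq_imp_less_iff winj)
      (simp_all add: xs_def)
  then show ?thesis
    unfolding geometrically_equivalent_def w_def using bij by blast
qed

section \<open>The equations in normal form\<close>

text \<open>
  The product of all differences between a vortex of the second pair and one of the first, which is the
  common denominator of the interactions across the pairs.
\<close>

definition cross_differences :: "real \<Rightarrow> real \<Rightarrow> real" where
  "cross_differences q r = (q - r + 1) * (q + r + 1) * (q - r - 1) * (q + r - 1)"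

lemma cross_differences_eq:
  "cross_differences q r = (q\<^sup>2 - 1 - r\<^sup>2)\<^sup>2 - 4 * r\<^sup>2"
  unfolding cross_differences_def by algebra

lemma inj_normal_config_iff:
  "inj (\<lambda>i. normal_config q r $ i) \<longleftrightarrow> r \<noteq> 0 \<and> cross_differences q r \<noteq> 0"
  unfolding inj_def forall_4 cross_differences_def by auto

text \<open>
  The constant \<open>c\<close> is eliminated by taking differences.  The three equations are the difference of the
  equations of the vortices within the first pair, within the second pair, and the difference of the sums
  over the two pairs, each cleared of its denominators.
\<close>

lemma rel_equilibrium_normal_config_iff:
  "collinear_rel_equilibrium (two_pairs m) (normal_config q r) \<longleftrightarrow>
    r \<noteq> 0 \<and> cross_differences q r \<noteq> 0 \<and>
    (\<exists>l. l \<noteq> 0 \<and>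
      2 * l * cross_differences q r = cross_differences q r - 4 * m * (q\<^sup>2 + r\<^sup>2 - 1) \<and>
      2 * l * r\<^sup>2 * cross_differences q r = m * cross_differences q r - 4 * r\<^sup>2 * (q\<^sup>2 + 1 - r\<^sup>2) \<and>
      l * q * cross_differences q r = 2 * (1 + m) * q * (q\<^sup>2 - r\<^sup>2 - 1))"
proof (cases "r \<noteq> 0 \<and> cross_differences q r \<noteq> 0")
  case False
  then show ?thesis
    unfolding collinear_rel_equilibrium_def inj_normal_config_iff by auto
next
  case True
  define a where "a = q - r + 1"
  define b where "b = q + r + 1"
  define c where "c = q - r - 1"
  define d where "d = q + r - 1"
  define D where "D = cross_differences q r"
  have D: "D = a * b * c * d"
    by (simp add: D_def cross_differences_def a_def b_def c_def d_def)
  have r: "r \<noteq> 0" and nz: "a \<noteq> 0" "b \<noteq> 0" "c \<noteq> 0" "d \<noteq> 0" "D \<noteq> 0"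
    using True unfolding D_def[symmetric] by (auto simp: D)
  define S1 where "S1 = 1/2 + m / a + m / b"
  define S2 where "S2 = - 1/2 + m / c + m / d"
  define S3 where "S3 = - 1 / a - 1 / c + m / (2 * r)"
  define S4 where "S4 = - 1 / b - 1 / d - m / (2 * r)"
  have *: "-1 - (q - r) = - a" "1 - (q - r) = - c" "q + r - (q - r) = 2 * r"
          "-1 - (q + r) = - b" "1 - (q + r) = - d" "q - r - (q + r) = - 2 * r"
          "q - r - (-1) = a" "q + r - (-1) = b" "q - r - 1 = c" "q + r - 1 = d"
    by (simp_all add: a_def b_def c_def d_def)
  have eqs: "(\<forall>i. - l * (normal_config q r $ i - k) =
      (\<Sum>j\<in>UNIV - {i}. two_pairs m $ j / (normal_config q r $ j - normal_config q r $ i))) \<longleftrightarrow>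
      - l * (-1 - k) = S1 \<and> - l * (1 - k) = S2 \<and> - l * (q - r - k) = S3 \<and> - l * (q + r - k) = S4"
    for l k
    unfolding forall_4
    by (subst (1 2 3 4) sum_delete_conv_UNIV)
       (simp_all add: sum_4 two_pairs_def * S1_def S2_def S3_def S4_def del: minus_diff_eq diff_minus_eq_add)
  have elim: "(\<exists>k. - l * (-1 - k) = S1 \<and> - l * (1 - k) = S2 \<and> - l * (q - r - k) = S3 \<and> - l * (q + r - k) = S4)
     \<longleftrightarrow> S1 - S2 = 2 * l \<and> S3 - S4 = 2 * l * r \<and> S1 + S2 - S3 - S4 = 2 * l * q"
    if "l \<noteq> 0" for l
  proof
    assume "S1 - S2 = 2 * l \<and> S3 - S4 = 2 * l * r \<and> S1 + S2 - S3 - S4 = 2 * l * q"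
    moreover define k where "k = S1 / l - 1"
    have "l * k = S1 - l"
      using that by (simp add: k_def algebra_simps)
    ultimately show "\<exists>k. - l * (-1 - k) = S1 \<and> - l * (1 - k) = S2 \<and> - l * (q - r - k) = S3 \<and> - l * (q + r - k) = S4"
      by (intro exI[of _ k]) (simp add: algebra_simps)
  qed (auto simp: algebra_simps)
  have "D * (S1 - S2) = D - 4 * m * (q\<^sup>2 + r\<^sup>2 - 1)"
  proof -
    have "D * (S1 - S2) = D + m * (b * c * d + a * c * d - a * b * d - a * b * c)"
      unfolding S1_def S2_def D using nz by (simp add: field_simps)
    then show ?thesis
      unfolding a_def b_def c_def d_def by algebra
  qed
  then have 1: "S1 - S2 = 2 * l \<longleftrightarrow> 2 * l * D = D - 4 * m * (q\<^sup>2 + r\<^sup>2 - 1)" for l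
    using nz(5) by (metis mult.commute mult_left_cancel)
  have "r * D * (S3 - S4) = m * D - 4 * r\<^sup>2 * (q\<^sup>2 + 1 - r\<^sup>2)"
  proof -
    have "r * D * (S3 - S4) = m * D + r * (a * c * d + a * b * c - b * c * d - a * b * d)"
      unfolding S3_def S4_def D using nz r by (simp add: field_simps)
    then show ?thesis
      unfolding a_def b_def c_def d_def by algebra
  qed
  note ** = this
  have 2: "S3 - S4 = 2 * l * r \<longleftrightarrow> 2 * l * r\<^sup>2 * D = m * D - 4 * r\<^sup>2 * (q\<^sup>2 + 1 - r\<^sup>2)" for l
  proof -
    have "S3 - S4 = 2 * l * r \<longleftrightarrow> r * D * (S3 - S4) = r * D * (2 * l * r)"
      using nz(5) r by simp
    also have "r * D * (2 * l * r) = 2 * l * r\<^sup>2 * D"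
      by algebra
    finally show ?thesis
      unfolding ** by metis
  qed
  have "D * (S1 + S2 - S3 - S4) = 4 * (1 + m) * q * (q\<^sup>2 - r\<^sup>2 - 1)"
  proof -
    have "D * (S1 + S2 - S3 - S4) = (1 + m) * (b * c * d + a * c * d + a * b * d + a * b * c)"
      unfolding S1_def S2_def S3_def S4_def D using nz r by (simp add: field_simps)
    then show ?thesis
      unfolding a_def b_def c_def d_def by algebra
  qed
  note *** = this
  have 3: "S1 + S2 - S3 - S4 = 2 * l * q \<longleftrightarrow> l * q * D = 2 * (1 + m) * q * (q\<^sup>2 - r\<^sup>2 - 1)" for l
  proof -
    have "S1 + S2 - S3 - S4 = 2 * l * q \<longleftrightarrow> D * (S1 + S2 - S3 - S4) = D * (2 * l * q)"
      using nz(5) by simp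
    also have "D * (2 * l * q) = 2 * (l * q * D)"
      by algebra
    finally show ?thesis
      unfolding *** by linarith
  qed
  have "(\<exists>k. l \<noteq> 0 \<and>
      (- l * (-1 - k) = S1 \<and> - l * (1 - k) = S2 \<and> - l * (q - r - k) = S3 \<and> - l * (q + r - k) = S4)) \<longleftrightarrow>
      l \<noteq> 0 \<and> 2 * l * D = D - 4 * m * (q\<^sup>2 + r\<^sup>2 - 1) \<and>
      2 * l * r\<^sup>2 * D = m * D - 4 * r\<^sup>2 * (q\<^sup>2 + 1 - r\<^sup>2) \<and>
      l * q * D = 2 * (1 + m) * q * (q\<^sup>2 - r\<^sup>2 - 1)" for l
    using elim[of l] unfolding 1 2 3 by blast
  then show ?thesis
    using True
    unfolding collinear_rel_equilibrium_def inj_normal_config_iff eqs D_def[symmetric]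
    by simp
qed

text \<open>
  For \<open>q = 0\<close> the third equation is void, and eliminating \<open>l\<close> from the other two leaves
  \<open>1 - r\<^sup>2\<close> times a quadratic in \<open>r\<^sup>2\<close>.
\<close>

lemma central_rel_equilibrium_iff:
  assumes "-1 < m" "m \<noteq> 0"
  shows "collinear_rel_equilibrium (two_pairs m) (normal_config 0 r) \<longleftrightarrow>
    r \<noteq> 0 \<and> (r\<^sup>2)\<^sup>2 - 5 * (1 + m) * r\<^sup>2 + m = 0"
proof -
  define R where "R = r\<^sup>2"
  define D where "D = cross_differences 0 r"
  have D: "D = (1 - R)\<^sup>2"
    unfolding D_def R_def cross_differences_eq by (simp add: power2_eq_square algebra_simps)
  have Rpos: "R > 0" if "r \<noteq> 0"
    using that by (simp add: R_def)
  show ?thesis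
    unfolding rel_equilibrium_normal_config_iff D_def[symmetric] R_def[symmetric] zero_power2
  proof (intro iffI conjI; (elim conjE exE)?)
    fix l assume r: "r \<noteq> 0" and D0: "D \<noteq> 0" and
      "2 * l * D = D - 4 * m * (0 + R - 1)"
      "2 * l * R * D = m * D - 4 * R * (0 + 1 - R)"
    then have "R * (D - 4 * m * (R - 1)) = m * D - 4 * R * (1 - R)"
      by algebra
    then have "(1 - R) * (R\<^sup>2 - 5 * (1 + m) * R + m) = 0"
      unfolding D by algebra
    then show "R\<^sup>2 - 5 * (1 + m) * R + m = 0"
      using D0 by (auto simp: D)
  next
    assume r: "r \<noteq> 0" and e: "R\<^sup>2 - 5 * (1 + m) * R + m = 0"
    have "R \<noteq> 1"
      using e assms by auto
    then show "D \<noteq> 0" by (simp add: D)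
    \<comment> \<open>the value that solves the first equation; the quadratic equation is what makes it solve the second\<close>
    define l where "l = 1/2 - 2 * m / (R - 1)"
    have l: "2 * l * (R - 1) = R - 1 - 4 * m"
      unfolding l_def using \<open>R \<noteq> 1\<close> by (simp add: field_simps)
    have l1: "2 * l * R * (R - 1) = m * (R - 1) + 4 * R"
      using l e by algebra
    have "l \<noteq> 0"
    proof
      assume "l = 0"
      with l l1 have "R = 1 + 4 * m" "m * (4 * m) + 4 * R = 0"
        by auto
      then have "R = - m\<^sup>2"
        by (simp add: power2_eq_square)
      with Rpos[OF r] show False by (simp add: not_less)
    qed
    moreover have "2 * l * D = D - 4 * m * (0 + R - 1)" "2 * l * R * D = m * D - 4 * R * (0 + 1 - R)"
      unfolding D using l l1 by algebra+
    ultimately show "\<exists>l. l \<noteq> 0 \<and> 2 * l * D = D - 4 * m * (0 + R - 1) \<and>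
      2 * l * R * D = m * D - 4 * R * (0 + 1 - R) \<and> l * 0 * D = 2 * (1 + m) * 0 * (0 - R - 1)"
      by auto
  qed
qed

text \<open>
  For \<open>q \<noteq> 0\<close> the third equation determines \<open>l\<close>.  Substituted into the other two, where the product of cross
  differences is \<open>(Q - 1 - R)\<^sup>2 - 4 * R\<close> with \<open>Q = q\<^sup>2\<close> and \<open>R = r\<^sup>2\<close>, the terms \<open>4 * R\<close> cancel and
  the equations below remain.
\<close>

definition off_centre_eqs :: "real \<Rightarrow> real \<Rightarrow> real \<Rightarrow> bool" where
  "off_centre_eqs m Q R \<longleftrightarrow> (Q - 1 - R)\<^sup>2 = 4 * (1 + 2 * m) * (Q - 1) \<and>
     m * (Q - 1 - R)\<^sup>2 = 4 * (2 + m) * R * (Q - R)"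

text \<open>
  Conversely, these equations already exclude collisions and a vanishing multiplier when \<open>m > -1\<close>:
  a collision would force \<open>(1 + m)\<^sup>2 = 0\<close>, and a vanishing multiplier means \<open>Q - 1 - R = 0\<close>, which would force \<open>R = 0\<close>.
\<close>

lemma off_centre_rel_equilibrium_iff:
  assumes "-1 < m" "m \<noteq> 0" "q \<noteq> 0"
  shows "collinear_rel_equilibrium (two_pairs m) (normal_config q r) \<longleftrightarrow>
    r \<noteq> 0 \<and> off_centre_eqs m (q\<^sup>2) (r\<^sup>2)"
proof -
  define Q where "Q = q\<^sup>2"
  define R where "R = r\<^sup>2"
  define D where "D = cross_differences q r"
  have D: "D = (Q - 1 - R)\<^sup>2 - 4 * R"
    unfolding D_def R_def Q_def cross_differences_eq ..
  have Rpos: "R > 0" if "r \<noteq> 0"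
    using that by (simp add: R_def)
  show ?thesis
    unfolding rel_equilibrium_normal_config_iff off_centre_eqs_def D_def[symmetric] R_def[symmetric] Q_def[symmetric]
  proof (intro iffI conjI; (elim conjE exE)?)
    fix l assume r: "r \<noteq> 0" and D0: "D \<noteq> 0" and
      e: "2 * l * D = D - 4 * m * (Q + R - 1)"
      "2 * l * R * D = m * D - 4 * R * (Q + 1 - R)"
      "l * q * D = 2 * (1 + m) * q * (Q - R - 1)"
    have "q * (l * D) = q * (2 * (1 + m) * (Q - R - 1))"
      using e(3) by algebra
    then have l: "l * D = 2 * (1 + m) * (Q - R - 1)"
      using assms(3) by simp
    show "(Q - 1 - R)\<^sup>2 = 4 * (1 + 2 * m) * (Q - 1)"
      using e(1) l unfolding D by algebra
    show "m * (Q - 1 - R)\<^sup>2 = 4 * (2 + m) * R * (Q - R)"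
      using e(2) l unfolding D by algebra
  next
    assume r: "r \<noteq> 0" and e: "(Q - 1 - R)\<^sup>2 = 4 * (1 + 2 * m) * (Q - 1)"
      "m * (Q - 1 - R)\<^sup>2 = 4 * (2 + m) * R * (Q - R)"
    show "D \<noteq> 0"
    proof
      assume "D = 0"
      then have "R = (1 + 2 * m) * (Q - 1)" "R * m = R * ((2 + m) * (Q - R))"
        using e unfolding D by algebra+
      then have 1: "R = (1 + 2 * m) * (Q - 1)" and 2: "m = (2 + m) * (Q - R)"
        using Rpos[OF r] by auto
      have "(2 + m)\<^sup>2 * R = 1"
        using 2 \<open>D = 0\<close> unfolding D by algebra
      then have "(1 + m)\<^sup>2 = 0"
        using 1 2 by algebra
      then show False using assms by simp
    qed
    have "Q - 1 - R \<noteq> 0"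
    proof
      assume "Q - 1 - R = 0"
      then have "Q - R = 1" by simp
      with e(2) have "(2 + m) * R = 0"
        using \<open>Q - 1 - R = 0\<close> \<open>Q - R = 1\<close> by algebra
      with Rpos[OF r] assms show False by simp
    qed
    \<comment> \<open>the value that solves the third equation, which reduces the other two to \<open>off_centre_eqs\<close>\<close>
    define l where "l = 2 * (1 + m) * (Q - R - 1) / D"
    have l: "l * D = 2 * (1 + m) * (Q - R - 1)"
      using \<open>D \<noteq> 0\<close> by (simp add: l_def)
    have "l \<noteq> 0"
      using \<open>Q - 1 - R \<noteq> 0\<close> assms \<open>D \<noteq> 0\<close> by (auto simp: l_def)
    moreover have "2 * l * D = D - 4 * m * (Q + R - 1)"
      using l e(1) unfolding D by algebra
    moreover have "2 * l * R * D = m * D - 4 * R * (Q + 1 - R)"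
      using l e(2) unfolding D by algebra
    moreover have "l * q * D = 2 * (1 + m) * q * (Q - R - 1)"
      using l by algebra
    ultimately show "\<exists>l. l \<noteq> 0 \<and> 2 * l * D = D - 4 * m * (Q + R - 1) \<and>
      2 * l * R * D = m * D - 4 * R * (Q + 1 - R) \<and> l * q * D = 2 * (1 + m) * q * (Q - R - 1)"
      by blast
  qed
qed

section \<open>Solving the off-centre equations\<close>

text \<open>
  In terms of \<open>s = R - Q\<close> one has \<open>Q - 1 - R = -(1 + s)\<close>.  The first equation then gives \<open>Q\<close> as a
  function of \<open>s\<close>.  In the second one a factor \<open>1 + s\<close> can be divided out, since \<open>s = -1\<close> would give
  \<open>Q = 1\<close> and \<open>R = 0\<close>, and a quadratic equation for \<open>s\<close> is left.
\<close>

definition off_centre_Q :: "real \<Rightarrow> real \<Rightarrow> real" where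
  "off_centre_Q m s = 1 + (1 + s)\<^sup>2 / (4 * (1 + 2 * m))"

definition off_centre_poly :: "real \<Rightarrow> real \<Rightarrow> real" where
  "off_centre_poly m s = (2 + m) * s\<^sup>2 + (m * (1 + 2 * m) + (2 + m) * (5 + 8 * m)) * s + m * (1 + 2 * m)"

text \<open>
  The condition \<open>m * s < 0\<close> encodes \<open>R > 0\<close>, because the second equation reads
  \<open>m * (1 + s)\<^sup>2 = -4 * (2 + m) * R * s\<close>.
\<close>

lemma off_centre_root_facts:
  assumes m: "-1/2 < m" "m \<noteq> 0" and s: "m * s < 0" "off_centre_poly m s = 0"
  shows "0 < off_centre_Q m s" "0 < off_centre_Q m s + s"
    "off_centre_eqs m (off_centre_Q m s) (off_centre_Q m s + s)"
proof -
  define k where "k = 1 + 2 * m"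
  define Q where "Q = off_centre_Q m s"
  have k: "k > 0" using m by (simp add: k_def)
  have Qk: "4 * k * (Q - 1) = (1 + s)\<^sup>2"
    using k by (simp add: Q_def off_centre_Q_def k_def[symmetric])
  have "Q \<ge> 1"
    using k by (simp add: Q_def off_centre_Q_def k_def[symmetric])
  then show "0 < off_centre_Q m s" by (simp add: Q_def)
  have s1: "1 + s \<noteq> 0"
  proof
    assume "1 + s = 0"
    then have "4 * k * (2 + m) = 0"
      using s(2) unfolding off_centre_poly_def k_def by algebra
    with k m show False by simp
  qed
  have "k * (m * (1 + s)\<^sup>2) = k * (- 4 * (2 + m) * s * (Q + s))"
    using Qk s(2) unfolding off_centre_poly_def k_def by algebra
  then have R: "m * (1 + s)\<^sup>2 = - 4 * (2 + m) * s * (Q + s)"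
    using k by simp
  have "(4 * (2 + m) * (- (m * s))) * (Q + s) = m\<^sup>2 * (1 + s)\<^sup>2"
    using R by algebra
  also have "\<dots> > 0"
    using s1 m by (simp add: zero_less_mult_iff)
  finally have "(4 * (2 + m) * (- (m * s))) * (Q + s) > 0" .
  moreover have "4 * (2 + m) * (- (m * s)) > 0"
    using m s(1) by (intro mult_pos_pos) auto
  ultimately show "0 < off_centre_Q m s + s"
    unfolding Q_def by (metis zero_less_mult_pos)
  show "off_centre_eqs m (off_centre_Q m s) (off_centre_Q m s + s)"
    unfolding off_centre_eqs_def Q_def[symmetric] k_def[symmetric]
    using Qk R by algebra
qed

lemma off_centre_eqs_iff:
  assumes m: "-1/2 < m" "m \<noteq> 0" and "R > 0"
  shows "off_centre_eqs m Q R \<longleftrightarrow>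
    (\<exists>s. m * s < 0 \<and> off_centre_poly m s = 0 \<and> Q = off_centre_Q m s \<and> R = off_centre_Q m s + s)"
proof
  assume e: "off_centre_eqs m Q R"
  define k where "k = 1 + 2 * m"
  define s where "s = R - Q"
  have k: "k > 0" using m by (simp add: k_def)
  have e1: "(1 + s)\<^sup>2 = 4 * k * (Q - 1)" and e2: "m * (1 + s)\<^sup>2 = - 4 * (2 + m) * R * s"
    using e unfolding off_centre_eqs_def k_def[symmetric] s_def by algebra+
  have Q: "Q = off_centre_Q m s"
    unfolding off_centre_Q_def k_def[symmetric] e1 using k by simp
  have s1: "1 + s \<noteq> 0"
  proof
    assume "1 + s = 0"
    with e1 k have "Q = 1" by simp
    with \<open>1 + s = 0\<close> \<open>R > 0\<close> show False by (simp add: s_def)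
  qed
  have s0: "s \<noteq> 0"
    using e2 m(2) by auto
  have "(1 + s)\<^sup>2 * (m * s) = - (4 * (2 + m) * R * s\<^sup>2)"
    using e2 by algebra
  also have "\<dots> < 0"
    using m s0 \<open>R > 0\<close> by simp
  finally have "m * s < 0"
    using s1 by (simp add: mult_less_0_iff not_less)
  moreover have "(1 + s) * off_centre_poly m s = 0"
  proof -
    have R: "R = Q + s" by (simp add: s_def)
    have poly: "off_centre_poly m s = m * k * (1 + s) + (2 + m) * s * (1 + s + 4 * k)"
      unfolding off_centre_poly_def k_def by algebra
    show ?thesis
      using e1 e2 unfolding poly R by algebra
  qed
  ultimately show "\<exists>s. m * s < 0 \<and> off_centre_poly m s = 0 \<and> Q = off_centre_Q m s \<and> R = off_centre_Q m s + s"
    using Q[symmetric] s1 by (intro exI[of _ s]) (simp add: s_def)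
qed (use off_centre_root_facts[OF m] in blast)

text \<open>
  For \<open>-1 < m \<le> -1/2\<close> a solution would have \<open>A = 1 - Q\<close> and \<open>B = R - Q\<close> positive.  The number
  \<open>X = 1 + R - Q\<close> is the sum of \<open>A\<close> and \<open>R\<close>, and also of \<open>B\<close> and \<open>1\<close>, so that by the inequality of
  arithmetic and geometric means \<open>X ^ 4 \<ge> 16 * A * B * R\<close>.  The product of the equations gives
  \<open>X ^ 4 = 16 * K * A * B * R\<close> with \<open>K = (1 + 2 * m) * (2 + m) / m\<close>, and \<open>K < 1\<close>
  since \<open>1 - K = -2 * (1 + m)\<^sup>2 / m\<close>, a contradiction.
\<close>

lemma no_off_centre_solution:
  assumes m: "-1 < m" "m \<le> -1/2" and "R > 0"
  shows "\<not> off_centre_eqs m Q R"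
proof
  assume e: "off_centre_eqs m Q R"
  define A where "A = 1 - Q"
  define B where "B = R - Q"
  define X where "X = 1 + R - Q"
  have e1: "X\<^sup>2 = - 4 * (1 + 2 * m) * A" and e2: "- m * X\<^sup>2 = 4 * (2 + m) * R * B"
    using e unfolding off_centre_eqs_def A_def B_def X_def by algebra+
  have "B \<noteq> 0"
  proof
    assume "B = 0"
    with e2 m have "X = 0" by simp
    with \<open>B = 0\<close> have "Q = R" "R = 0 + (Q - 1)" by (simp_all add: A_def B_def X_def)
    then show False by simp
  qed
  have "- m * X\<^sup>2 \<ge> 0" using m by (intro mult_nonneg_nonneg) simp_all
  then have "(4 * (2 + m) * R) * B \<ge> 0" using e2 by simp
  moreover have "4 * (2 + m) * R > 0" using m \<open>R > 0\<close> by simp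
  ultimately have "B > 0"
    using \<open>B \<noteq> 0\<close> by (simp add: zero_le_mult_iff)
  have "X \<noteq> 0"
    using e2 \<open>B > 0\<close> \<open>4 * (2 + m) * R > 0\<close> by auto
  then have X2: "X\<^sup>2 > 0" by simp
  have "- (1 + 2 * m) * A > 0"
  proof -
    have "X\<^sup>2 = 4 * (- (1 + 2 * m) * A)"
      using e1 by algebra
    with X2 show ?thesis by linarith
  qed
  then have A: "A > 0"
    using m by (auto simp: zero_less_mult_iff)
  have "(- m) * (X\<^sup>2 * X\<^sup>2) = - 16 * (1 + 2 * m) * (2 + m) * (A * B * R)"
    using e1 e2 by algebra
  moreover have "(- m) * ((4 * (A * R)) * (4 * B)) \<le> (- m) * (X\<^sup>2 * X\<^sup>2)"
  proof (intro mult_left_mono mult_mono)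
    have "X\<^sup>2 - 4 * (A * R) = (A - R)\<^sup>2" "X\<^sup>2 - 4 * B = (B - 1)\<^sup>2"
      unfolding X_def A_def B_def by algebra+
    then show "4 * (A * R) \<le> X\<^sup>2" "4 * B \<le> X\<^sup>2"
      using zero_le_power2[of "A - R"] zero_le_power2[of "B - 1"] by linarith+
  qed (use m \<open>B > 0\<close> in simp_all)
  ultimately have "(- m) * (16 * (A * B * R)) \<le> - 16 * (1 + 2 * m) * (2 + m) * (A * B * R)"
    by (simp add: mult_ac)
  then have "(A * B * R) * (2 * (1 + m)\<^sup>2) \<le> 0"
    by (simp add: power2_eq_square algebra_simps)
  moreover have "(A * B * R) * (2 * (1 + m)\<^sup>2) > 0"
    using A \<open>B > 0\<close> \<open>R > 0\<close> m by (intro mult_pos_pos) simp_all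
  ultimately show False by linarith
qed

text \<open>
  For \<open>R = 1\<close> both right-hand sides are multiples of \<open>Q - 1\<close>, and comparing them gives
  \<open>m * (1 + 2 * m) = 2 + m\<close>, that is \<open>m\<^sup>2 = 1\<close>.  For \<open>m = 1\<close> the difference of the equations is
  proportional to \<open>(1 - R) * (Q - 1 - R)\<close>, and the second factor does not vanish because \<open>Q \<noteq> 1\<close>.
\<close>

lemma off_centre_equal_spreads_iff:
  assumes m: "-1 < m" "m \<noteq> 0" and e: "off_centre_eqs m Q R" "R > 0"
  shows "R = 1 \<longleftrightarrow> m = 1"
proof -
  have e1: "(Q - 1 - R)\<^sup>2 = 4 * (1 + 2 * m) * (Q - 1)" and
     e2: "m * (Q - 1 - R)\<^sup>2 = 4 * (2 + m) * R * (Q - R)"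
    using e(1) unfolding off_centre_eqs_def by auto
  have "Q \<noteq> 1"
    using e1 e(2) by auto
  show ?thesis
  proof
    assume "R = 1"
    then have "2 * ((m - 1) * (m + 1) * (Q - 1)) = 0"
      using e1 e2 by algebra
    then show "m = 1" using m \<open>Q \<noteq> 1\<close> by simp
  next
    assume "m = 1"
    then have "(1 - R) * (Q - 1 - R) = 0"
      using e1 e2 by algebra
    moreover have "Q - 1 - R \<noteq> 0"
      using e1 \<open>Q \<noteq> 1\<close> m \<open>m = 1\<close> by auto
    ultimately show "R = 1" by simp
  qed
qed

section \<open>Counting the parameters\<close>

lemma quadratic_two_roots:
  fixes p c :: real
  assumes "4 * c < p\<^sup>2"
  obtains s t where "s < t" "s + t = p" "s * t = c" "\<forall>x. x\<^sup>2 - p * x + c = 0 \<longleftrightarrow> x = s \<or> x = t"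
proof -
  define d where "d = sqrt (p\<^sup>2 - 4 * c)"
  have d: "d > 0" "d\<^sup>2 = p\<^sup>2 - 4 * c"
    using assms by (simp_all add: d_def)
  define s where "s = (p - d) / 2"
  define t where "t = (p + d) / 2"
  have st: "s + t = p" by (simp add: s_def t_def field_simps)
  have "4 * (s * t) = p\<^sup>2 - d\<^sup>2"
    by (simp add: s_def t_def power2_eq_square field_simps)
  then have c: "s * t = c" using d(2) by simp
  have "x\<^sup>2 - p * x + c = (x - s) * (x - t)" for x
    unfolding st[symmetric] c[symmetric] by algebra
  then have "x\<^sup>2 - p * x + c = 0 \<longleftrightarrow> x = s \<or> x = t" for x by simp
  moreover have "s < t" using d(1) by (simp add: s_def t_def)
  ultimately show ?thesis using that st c by blast
qed

lemma positive_quadratic_roots: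
  fixes p c :: real
  assumes "4 * c < p\<^sup>2" "0 < c" "0 < p"
  shows "finite {x. 0 < x \<and> x\<^sup>2 - p * x + c = 0} \<and> card {x. 0 < x \<and> x\<^sup>2 - p * x + c = 0} = 2"
proof -
  obtain s t where st: "s < t" "s + t = p" "s * t = c" "\<forall>x. x\<^sup>2 - p * x + c = 0 \<longleftrightarrow> x = s \<or> x = t"
    by (rule quadratic_two_roots[OF assms(1)])
  have "s > 0" "t > 0"
    using st assms by (auto simp: zero_less_mult_iff dest: less_trans)
  then have "{x. 0 < x \<and> x\<^sup>2 - p * x + c = 0} = {s, t}"
    using st(4) by auto
  then show ?thesis using st(1) by simp
qed

lemma unique_positive_quadratic_root:
  fixes p c :: real
  assumes "c < 0"
  shows "finite {x. 0 < x \<and> x\<^sup>2 - p * x + c = 0} \<and> card {x. 0 < x \<and> x\<^sup>2 - p * x + c = 0} = 1"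
proof -
  have "4 * c < p\<^sup>2"
    using assms zero_le_power2[of p] by linarith
  then obtain s t where st: "s < t" "s + t = p" "s * t = c" "\<forall>x. x\<^sup>2 - p * x + c = 0 \<longleftrightarrow> x = s \<or> x = t"
    by (rule quadratic_two_roots)
  have "s < 0" "t > 0"
    using st assms by (auto simp: mult_less_0_iff)
  then have "{x. 0 < x \<and> x\<^sup>2 - p * x + c = 0} = {t}"
    using st(4) by auto
  then show ?thesis by simp
qed

text \<open>
  For \<open>m > 0\<close> both roots are negative, as all coefficients are positive, and they are real and distinct because the polynomial, which is positive at
  \<open>0\<close>, is negative at \<open>-1\<close>.  For \<open>m < 0\<close> the product of the roots is negative.
\<close>

lemma off_centre_poly_roots:
  assumes m: "-1/2 < m" "m \<noteq> 0"
  shows "finite {s. m * s < 0 \<and> off_centre_poly m s = 0}"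
    and "card {s. m * s < 0 \<and> off_centre_poly m s = 0} = (if m > 0 then 2 else 1)"
proof -
  define p where "p = (m * (1 + 2 * m) + (2 + m) * (5 + 8 * m)) / (2 + m)"
  define c where "c = m * (1 + 2 * m) / (2 + m)"
  have "(2 + m) * p = m * (1 + 2 * m) + (2 + m) * (5 + 8 * m)" "(2 + m) * c = m * (1 + 2 * m)"
    using m by (simp_all add: p_def c_def)
  then have poly: "off_centre_poly m s = (2 + m) * (s\<^sup>2 + p * s + c)" for s
    unfolding off_centre_poly_def by algebra
  have "finite {s. m * s < 0 \<and> off_centre_poly m s = 0} \<and>
    card {s. m * s < 0 \<and> off_centre_poly m s = 0} = (if m > 0 then 2 else 1)"
  proof (cases "m > 0")
    case True
    have "p = c + (5 + 8 * m)"
      using m unfolding p_def c_def by (simp add: add_divide_distrib)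
    moreover have c: "c > 0" using True by (simp add: c_def)
    ultimately have p: "p > 1 + c" using True by simp
    have "4 * c \<le> (1 + c)\<^sup>2"
      using zero_le_power2[of "1 - c"] by (simp add: power2_eq_square algebra_simps)
    also have "\<dots> < p\<^sup>2"
      using p c by (intro power_strict_mono) auto
    finally have d: "4 * c < p\<^sup>2" .
    have "{s. m * s < 0 \<and> off_centre_poly m s = 0} = uminus ` {x. 0 < x \<and> x\<^sup>2 - p * x + c = 0}"
    proof (intro equalityI subsetI)
      fix s assume "s \<in> {s. m * s < 0 \<and> off_centre_poly m s = 0}"
      then show "s \<in> uminus ` {x. 0 < x \<and> x\<^sup>2 - p * x + c = 0}"
        using m True by (intro image_eqI[of _ _ "- s"]) (auto simp: poly mult_less_0_iff)
    qed (use m True in \<open>auto simp: poly mult_less_0_iff\<close>)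
    then show ?thesis
      using positive_quadratic_roots[OF d c] p c True by (simp add: card_image)
  next
    case False
    then have "c < 0" using m by (simp add: c_def divide_neg_pos mult_neg_pos)
    moreover have "{s. m * s < 0 \<and> off_centre_poly m s = 0} = {x. 0 < x \<and> x\<^sup>2 - (- p) * x + c = 0}"
      using m False by (auto simp: poly mult_less_0_iff)
    ultimately show ?thesis
      using unique_positive_quadratic_root[of c "- p"] False by simp
  qed
  then show "finite {s. m * s < 0 \<and> off_centre_poly m s = 0}"
    and "card {s. m * s < 0 \<and> off_centre_poly m s = 0} = (if m > 0 then 2 else 1)" by auto
qed

lemma card_square_fibre:
  assumes "0 < (s :: real)"
  shows "finite {x. x\<^sup>2 = s}" "card {x. x\<^sup>2 = s} = 2"
proof -
  have "{x. x\<^sup>2 = s} = {sqrt s, - sqrt s}"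
    using assms power2_eq_iff[of _ "sqrt s"] by auto
  then show "finite {x. x\<^sup>2 = s}" "card {x. x\<^sup>2 = s} = 2"
    using assms by simp_all
qed

lemma card_central_square_pairs:
  fixes T :: "real set"
  assumes "finite T" and "\<And>s. s \<in> T \<Longrightarrow> 0 < s"
  shows "finite {(q :: real, r). q = 0 \<and> r\<^sup>2 \<in> T}" "card {(q :: real, r). q = 0 \<and> r\<^sup>2 \<in> T} = 2 * card T"
proof -
  have e: "{(q :: real, r). q = 0 \<and> r\<^sup>2 \<in> T} = (\<Union>s\<in>T. {0} \<times> {r. r\<^sup>2 = s})"
    by auto
  show "finite {(q :: real, r). q = 0 \<and> r\<^sup>2 \<in> T}"
    unfolding e using assms by (intro finite_UN_I finite_cartesian_product card_square_fibre(1)) simp_all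
  have "card (\<Union>s\<in>T. {0 :: real} \<times> {r. r\<^sup>2 = s}) = (\<Sum>s\<in>T. card ({0 :: real} \<times> {r. r\<^sup>2 = s}))"
    using assms by (intro card_UN_disjoint) (auto simp: card_square_fibre(1))
  also have "\<dots> = (\<Sum>s\<in>T. 2)"
    using assms(2) by (intro sum.cong refl) (simp add: card_cartesian_product card_square_fibre)
  finally show "card {(q :: real, r). q = 0 \<and> r\<^sup>2 \<in> T} = 2 * card T"
    unfolding e by simp
qed

text \<open>
  The fibres over different \<open>s\<close> are disjoint, since \<open>s = r\<^sup>2 - q\<^sup>2\<close>.
\<close>

lemma card_square_pairs:
  fixes h :: "real \<Rightarrow> real"
  assumes "finite T" and "\<And>s. s \<in> T \<Longrightarrow> 0 < h s" "\<And>s. s \<in> T \<Longrightarrow> 0 < h s + s"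
  shows "finite {(q, r). \<exists>s\<in>T. q\<^sup>2 = h s \<and> r\<^sup>2 = h s + s}"
    "card {(q, r). \<exists>s\<in>T. q\<^sup>2 = h s \<and> r\<^sup>2 = h s + s} = 4 * card T"
proof -
  have e: "{(q, r). \<exists>s\<in>T. q\<^sup>2 = h s \<and> r\<^sup>2 = h s + s} = (\<Union>s\<in>T. {q. q\<^sup>2 = h s} \<times> {r. r\<^sup>2 = h s + s})"
    by auto
  show "finite {(q, r). \<exists>s\<in>T. q\<^sup>2 = h s \<and> r\<^sup>2 = h s + s}"
    unfolding e using assms by (intro finite_UN_I finite_cartesian_product card_square_fibre(1)) simp_all
  have "card (\<Union>s\<in>T. {q. q\<^sup>2 = h s} \<times> {r. r\<^sup>2 = h s + s}) = (\<Sum>s\<in>T. card ({q. q\<^sup>2 = h s} \<times> {r. r\<^sup>2 = h s + s}))"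
    using assms by (intro card_UN_disjoint) (auto simp: card_square_fibre(1))
  also have "\<dots> = (\<Sum>s\<in>T. 4)"
    using assms(2,3) by (intro sum.cong refl) (simp add: card_cartesian_product card_square_fibre)
  finally show "card {(q, r). \<exists>s\<in>T. q\<^sup>2 = h s \<and> r\<^sup>2 = h s + s} = 4 * card T"
    unfolding e by simp
qed

lemma card_central_equilibria:
  assumes "-1 < m" "m \<noteq> 0"
  defines "S \<equiv> {(q, r). collinear_rel_equilibrium (two_pairs m) (normal_config q r) \<and> q = 0}"
  shows "finite S" "card S = (if m > 0 then 4 else 2)"
proof -
  define T where "T = {R. 0 < R \<and> R\<^sup>2 - 5 * (1 + m) * R + m = 0}"
  have "S = {(q, r). q = 0 \<and> r\<^sup>2 \<in> T}"
    using central_rel_equilibrium_iff[OF assms(1,2)] by (auto simp: S_def T_def)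
  moreover have "finite T \<and> card T = (if m > 0 then 2 else 1)"
  proof (cases "m > 0")
    case True
    have "(5 * (1 + m))\<^sup>2 - 4 * m = 25 + 46 * m + 25 * m\<^sup>2"
      by (simp add: power2_eq_square algebra_simps)
    also have "\<dots> > 0"
      using True by (intro add_pos_nonneg) simp_all
    finally have "4 * m < (5 * (1 + m))\<^sup>2" by simp
    then show ?thesis
      using positive_quadratic_roots[of m "5 * (1 + m)"] True by (simp add: T_def)
  next
    case False
    then show ?thesis
      using unique_positive_quadratic_root[of m "5 * (1 + m)"] assms(2) by (simp add: T_def)
  qed
  moreover have "0 < R" if "R \<in> T" for R
    using that by (simp add: T_def)
  ultimately show "finite S" "card S = (if m > 0 then 4 else 2)"
    using card_central_square_pairs[of T] by simp_all
qed

lemma card_off_centre_equilibria: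
  assumes "-1/2 < m" "m \<noteq> 0"
  defines "S \<equiv> {(q, r). collinear_rel_equilibrium (two_pairs m) (normal_config q r) \<and> q \<noteq> 0}"
  shows "finite S" "card S = (if m > 0 then 8 else 4)"
proof -
  define T where "T = {s. m * s < 0 \<and> off_centre_poly m s = 0}"
  note pos = off_centre_root_facts(1,2)[OF assms(1,2)]
  have "(q, r) \<in> S \<longleftrightarrow> (\<exists>s\<in>T. q\<^sup>2 = off_centre_Q m s \<and> r\<^sup>2 = off_centre_Q m s + s)" for q r
  proof (cases "q = 0 \<or> r = 0")
    case True
    moreover have "(q, r) \<notin> S"
      using True off_centre_rel_equilibrium_iff[of m q r] assms(1,2) by (auto simp: S_def)
    moreover have "\<not> (q\<^sup>2 = off_centre_Q m s \<and> r\<^sup>2 = off_centre_Q m s + s)" if "s \<in> T" for s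
      using True pos[of s] that by (auto simp: T_def)
    ultimately show ?thesis by blast
  next
    case False
    then show ?thesis
      using off_centre_rel_equilibrium_iff[of m q r] off_centre_eqs_iff[OF assms(1,2), of "r\<^sup>2" "q\<^sup>2"] assms(1,2)
      by (auto simp: S_def T_def)
  qed
  then have "S = {(q, r). \<exists>s\<in>T. q\<^sup>2 = off_centre_Q m s \<and> r\<^sup>2 = off_centre_Q m s + s}"
    by auto
  moreover have "finite T" "card T = (if m > 0 then 2 else 1)"
    using off_centre_poly_roots[OF assms(1,2)] by (simp_all add: T_def)
  moreover have "0 < off_centre_Q m s" "0 < off_centre_Q m s + s" if "s \<in> T" for s
    using that pos by (simp_all add: T_def)
  ultimately show "finite S" "card S = (if m > 0 then 8 else 4)"
    using card_square_pairs[of T "off_centre_Q m"] by simp_all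
qed

lemma no_off_centre_equilibrium:
  assumes "-1 < m" "m \<le> -1/2" "q \<noteq> 0"
  shows "\<not> collinear_rel_equilibrium (two_pairs m) (normal_config q r)"
  using off_centre_rel_equilibrium_iff[of m q r] no_off_centre_solution[of m "r\<^sup>2" "q\<^sup>2"] assms by auto

section \<open>Counting the solutions\<close>

lemma card_solutions:
  assumes "-1/2 < m" "m \<noteq> 0"
  shows "card (solutions m) = (if m > 0 then 12 else 6)"
proof -
  let ?E = "\<lambda>q r. collinear_rel_equilibrium (two_pairs m) (normal_config q r)"
  have "card (solutions m) = card {(q, r). ?E q r}"
    unfolding solutions_def
    by (subst card_affine_classes)
      (auto simp: collinear_rel_equilibrium_affine collinear_rel_equilibrium_imp_inj)
  also have "{(q, r). ?E q r} = {(q, r). ?E q r \<and> q = 0} \<union> {(q, r). ?E q r \<and> q \<noteq> 0}"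
    by auto
  also have "card \<dots> = card {(q, r). ?E q r \<and> q = 0} + card {(q, r). ?E q r \<and> q \<noteq> 0}"
    using card_central_equilibria(1)[of m] card_off_centre_equilibria(1)[of m] assms
    by (intro card_Un_disjoint) auto
  finally show ?thesis
    using card_central_equilibria(2)[of m] card_off_centre_equilibria(2)[of m] assms by simp
qed

lemma symmetric_equilibrium_iff:
  assumes "-1 < m" "m \<noteq> 0" "collinear_rel_equilibrium (two_pairs m) (normal_config q r)"
  shows "symmetric_config (normal_config q r) \<longleftrightarrow> q = 0 \<or> m = 1"
proof -
  have inj: "inj (\<lambda>i. normal_config q r $ i)"
    using assms(3) by (simp add: collinear_rel_equilibrium_def)
  have "r\<^sup>2 = 1 \<longleftrightarrow> m = 1" if "q \<noteq> 0"
    using off_centre_equal_spreads_iff[of m "q\<^sup>2" "r\<^sup>2"] off_centre_rel_equilibrium_iff[of m q r] that assms by simp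
  then show ?thesis
    unfolding symmetric_normal_config_iff[OF inj] by blast
qed

lemma card_symmetric_solutions:
  assumes "-1 < m" "m \<noteq> 0" "m \<noteq> 1"
  shows "card (symmetric_solutions m) = (if m > 0 then 4 else 2)"
proof -
  let ?A = "{x. collinear_rel_equilibrium (two_pairs m) x \<and> symmetric_config x}"
  have "card (symmetric_solutions m) = card {(q, r). normal_config q r \<in> ?A}"
    unfolding symmetric_solutions_def
    by (rule card_affine_classes)
      (auto simp: collinear_rel_equilibrium_affine symmetric_config_affine_iff collinear_rel_equilibrium_imp_inj)
  also have "{(q, r). normal_config q r \<in> ?A} =
      {(q, r). collinear_rel_equilibrium (two_pairs m) (normal_config q r) \<and> q = 0}"
    using symmetric_equilibrium_iff[OF assms(1,2)] assms(3) by auto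
  finally show ?thesis
    using card_central_equilibria(2)[OF assms(1,2)] by simp
qed

lemma bij_betw_asymmetric_solutions:
  assumes "-1 < m" "m \<noteq> 0" "m \<noteq> 1"
  shows "bij_betw (\<lambda>(q, r). config_rel `` {normal_config q r})
    {(q, r). collinear_rel_equilibrium (two_pairs m) (normal_config q r) \<and> q \<noteq> 0} (asymmetric_solutions m)"
proof -
  let ?A = "{x. collinear_rel_equilibrium (two_pairs m) x \<and> \<not> symmetric_config x}"
  have "{(q, r). normal_config q r \<in> ?A} =
      {(q, r). collinear_rel_equilibrium (two_pairs m) (normal_config q r) \<and> q \<noteq> 0}"
    using symmetric_equilibrium_iff[OF assms(1,2)] assms(3) by auto
  moreover have "bij_betw (\<lambda>(q, r). config_rel `` {normal_config q r})
    {(q, r). normal_config q r \<in> ?A} (?A // config_rel)"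
    by (rule bij_betw_normal_config_classes)
      (auto simp: collinear_rel_equilibrium_affine symmetric_config_affine_iff collinear_rel_equilibrium_imp_inj)
  ultimately show ?thesis
    by (simp add: asymmetric_solutions_def)
qed

theorem theorem5p2:
  fixes m :: real
  shows
    "(m \<in> {0<..1} \<longrightarrow>
        card (solutions m) = 12 \<and>
        bij_betw (\<lambda>C. vortex_order ` C) (solutions m) orderings_up_to_reversal) \<and>
     (m = 1 \<longrightarrow>
        (\<forall>x. collinear_rel_equilibrium (two_pairs m) x \<longrightarrow> symmetric_config x) \<and>
        (\<exists>z. collinear_rel_equilibrium (two_pairs m) z \<and>
             (\<forall>x. collinear_rel_equilibrium (two_pairs m) x \<longrightarrow> geometrically_equivalent x z))) \<and>
     (m \<in> {0<..<1} \<longrightarrow>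
        card (symmetric_solutions m) = 4 \<and> card (asymmetric_solutions m) = 8) \<and>
     (m \<in> {-1/2<..<0} \<longrightarrow>
        card (solutions m) = 6 \<and>
        card (symmetric_solutions m) = 2 \<and> card (asymmetric_solutions m) = 4) \<and>
     (m \<in> {-1<..-1/2} \<longrightarrow>
        card (solutions m) = 2 \<and>
        card (symmetric_solutions m) = 2 \<and> asymmetric_solutions m = {})"
proof (intro conjI impI)
  assume m: "m \<in> {0<..1}"
  then show card: "card (solutions m) = 12"
    using card_solutions[of m] by simp
  have "two_pairs m $ i > 0" for i
    using m by (simp add: two_pairs_def)
  then show "bij_betw (\<lambda>C. vortex_order ` C) (solutions m) orderings_up_to_reversal"
    using card unfolding solutions_def by (rule bij_betw_orderings)
next
  assume "m = 1"
  show "\<forall>x. collinear_rel_equilibrium (two_pairs m) x \<longrightarrow> symmetric_config x"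
  proof (intro allI impI)
    fix x assume x: "collinear_rel_equilibrium (two_pairs m) x"
    obtain a b q r where a: "a \<noteq> 0" and y: "(\<chi> i. a * x $ i + b) = normal_config q r"
      using affine_image_normal_config[OF collinear_rel_equilibrium_imp_inj[OF x]] by blast
    have "collinear_rel_equilibrium (two_pairs m) (normal_config q r)"
      using collinear_rel_equilibrium_affine[OF x a, of b] by (simp add: y)
    then have "symmetric_config (normal_config q r)"
      using symmetric_equilibrium_iff[of m q r] \<open>m = 1\<close> by simp
    then show "symmetric_config x"
      using symmetric_config_affine_iff[OF a, of x b] by (simp add: y)
  qed
  have "card (solutions m) = 12"
    using card_solutions[of m] \<open>m = 1\<close> by simp
  then have "solutions m \<noteq> {}"
    by auto
  then obtain z where z: "collinear_rel_equilibrium (two_pairs m) z"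
    unfolding solutions_def quotient_def by auto
  have "two_pairs m $ i = 1" for i
    using \<open>m = 1\<close> by (simp add: two_pairs_def)
  then have "geometrically_equivalent x z" if "collinear_rel_equilibrium (two_pairs m) x" for x
    using equal_strengths_geometrically_equivalent[of "two_pairs m" 1 x z] that z by simp
  with z show "\<exists>z. collinear_rel_equilibrium (two_pairs m) z \<and>
      (\<forall>x. collinear_rel_equilibrium (two_pairs m) x \<longrightarrow> geometrically_equivalent x z)"
    by blast
next
  assume m: "m \<in> {0<..<1}"
  then show "card (symmetric_solutions m) = 4"
    using card_symmetric_solutions[of m] by simp
  show "card (asymmetric_solutions m) = 8"
    using bij_betw_same_card[OF bij_betw_asymmetric_solutions[of m]] card_off_centre_equilibria(2)[of m] m by simp
next
  assume m: "m \<in> {-1/2<..<0}"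
  then show "card (solutions m) = 6"
    using card_solutions[of m] by simp
  show "card (symmetric_solutions m) = 2"
    using card_symmetric_solutions[of m] m by simp
  show "card (asymmetric_solutions m) = 4"
    using bij_betw_same_card[OF bij_betw_asymmetric_solutions[of m]] card_off_centre_equilibria(2)[of m] m by simp
next
  assume m: "m \<in> {-1<..-1/2}"
  then show sym: "card (symmetric_solutions m) = 2"
    using card_symmetric_solutions[of m] by simp
  have none: "{(q, r). collinear_rel_equilibrium (two_pairs m) (normal_config q r) \<and> q \<noteq> 0} = {}"
    using no_off_centre_equilibrium[of m] m by auto
  have "-1 < m" "m \<noteq> 0" "m \<noteq> 1"
    using m by auto
  from bij_betw_imp_surj_on[OF bij_betw_asymmetric_solutions[OF this]]
  show asym: "asymmetric_solutions m = {}"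
    unfolding none by (simp only: image_empty)
  have "{x. collinear_rel_equilibrium (two_pairs m) x} =
      {x. collinear_rel_equilibrium (two_pairs m) x \<and> symmetric_config x}"
    using asym unfolding asymmetric_solutions_def quotient_def by auto
  then have "solutions m = symmetric_solutions m"
    unfolding solutions_def symmetric_solutions_def by (rule arg_cong)
  with sym show "card (solutions m) = 2" by simp
qed

end
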